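(* There exists $q\in L^2(\mathbb{R})$ such that, for every $k\in\mathbb{R}$, neither of the limits $\lim_{T\to\infty}\mathfrak{a}(k,q^{\langle T\rangle})$ and $\lim_{T\to\infty}\mathfrak{b}(k,q^{\langle T\rangle})$ exists.
   Context: For $q\in L^1_{\mathrm{loc}}(\mathbb{R})$ and $T>0$ let $q^{\langle T\rangle}=q\chi_{|x|<T}$. For $k\in\mathbb{R}$ let $\widetilde X(x,k)$ be the $2\times2$ matrix solution of $\partial_x\widetilde X=\begin{pmatrix}0&\overline{q^{\langle T\rangle}(x)}e^{-ikx}\\ q^{\langle T\rangle}(x)e^{ikx}&0\end{pmatrix}\widetilde X$ with $\widetilde X(x,k)=I$ for $x\leqslant -T$. For $x\geqslant T$ it is constant and equals $\begin{pmatrix}\mathfrak{a}(k,q^{\langle T\rangle})&\mathfrak{b}^\#(k,q^{\langle T\rangle})\\ \mathfrak{b}(k,q^{\langle T\rangle})&\mathfrak{a}^\#(k,q^{\langle T\rangle})\end{pmatrix}$, where $f^\#(k)=\overline{f(\bar k)}$; this defines the $SU(1,1)$ nonlinear Fourier transform $(\mathfrak{a},\mathfrak{b})$ on $\mathbb{R}$. *)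

theory Defs
  imports "HOL-Analysis.Analysis"
begin

definition trunc :: "(real \<Rightarrow> complex) \<Rightarrow> real \<Rightarrow> real \<Rightarrow> complex" where
  "trunc q T x = (if \<bar>x\<bar> < T then q x else 0)"

definition L2_fun :: "(real \<Rightarrow> complex) \<Rightarrow> bool" where
  "L2_fun q \<longleftrightarrow> q \<in> borel_measurable lborel \<and> integrable lborel (\<lambda>x. (cmod (q x))\<^sup>2)"

text \<open>For a potential p supported in [-T,T], the first column (u,v) of the matrix
  solution X~(x,k) of  X' = [[0, conj(p) e^{-ikx}], [p e^{ikx}, 0]] X,  X(-T) = I,
  written as the (Caratheodory) integral equation on [-T,T].  Its value at x = T is
  (a(k,p), b(k,p)).\<close>
definition nlft_ab :: "(real \<Rightarrow> complex) \<Rightarrow> real \<Rightarrow> real \<Rightarrow> complex \<times> complex" where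
  "nlft_ab p k T = (THE ab. \<exists>u v :: real \<Rightarrow> complex.
      continuous_on {-T..T} u \<and> continuous_on {-T..T} v \<and>
      (\<forall>x\<in>{-T..T}.
         u x = 1 + (LINT s:{-T..x}|lborel. cnj (p s) * exp (- (\<i> * of_real (k * s))) * v s) \<and>
         v x = (LINT s:{-T..x}|lborel. p s * exp (\<i> * of_real (k * s)) * u s)) \<and>
      ab = (u T, v T))"

definition nlft_a :: "real \<Rightarrow> (real \<Rightarrow> complex) \<Rightarrow> real \<Rightarrow> complex" where
  "nlft_a k q T = fst (nlft_ab (trunc q T) k T)"

definition nlft_b :: "real \<Rightarrow> (real \<Rightarrow> complex) \<Rightarrow> real \<Rightarrow> complex" where
  "nlft_b k q T = snd (nlft_ab (trunc q T) k T)"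

end

theory Submission
  imports Defs
begin

text \<open>The potential is supported on the half line, so \<open>(a, b)\<close> at the cutoff \<open>T\<close> is the value at \<open>T\<close>
  of one global solution \<open>(u, v)\<close>. It consists of linear chirps \<open>c exp (-\<i>\<phi>)\<close>, \<open>\<phi>'' = 2\<beta>\<close>, whose
  frequency sweeps slowly over growing intervals. At frequency \<open>k\<close> and detuning \<open>d = k - \<phi>'\<close> the
  solution is, up to errors of relative size \<open>c/\<bar>d\<bar>\<close>, only rotated, at the rate \<open>c\<^sup>2/d\<close>. Between the
  detunings \<open>1\<close> and \<open>\<surd>\<beta>\<close> the angle is \<open>(c\<^sup>2/2\<beta>) ln (1/\<surd>\<beta>)\<close>. The mass \<open>\<integral>\<bar>q\<bar>\<^sup>2\<close> of a chirp is comparable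
  to \<open>c\<^sup>2/\<beta>\<close>, so the logarithm allows an angle \<open>\<pi>\<close> at arbitrarily small cost. Every chirp that sweeps
  across \<open>k\<close> therefore changes the sign of \<open>u\<close> and \<open>v\<close> up to a small error, and a limit could only be
  \<open>0\<close>. An initial piece \<open>exp (-x)/10\<close> on \<open>[0, 1)\<close> makes \<open>\<bar>v\<bar>\<close> at least \<open>1/(30(1 + \<bar>k\<bar>))\<close>, and the
  chirps are so weak that \<open>\<bar>u\<bar>\<close> and \<open>\<bar>v\<bar>\<close> stay away from \<open>0\<close> for each \<open>k\<close>.\<close>

subsection \<open>Volterra equations\<close>

lemma set_integrable_mult_continuous:
  fixes Q f :: "real \<Rightarrow> complex"
  assumes Q: "Q \<in> borel_measurable borel" and K: "\<And>x. norm (Q x) \<le> K"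
    and f: "continuous_on {a..b} f"
  shows "set_integrable lborel {a..b} (\<lambda>s. Q s * f s)"
proof -
  have "bounded (f ` {a..b})"
    by (intro compact_imp_bounded compact_continuous_image f) auto
  then obtain C where C: "\<And>x. x \<in> {a..b} \<Longrightarrow> norm (f x) \<le> C"
    unfolding bounded_iff by blast
  have m: "(\<lambda>x. indicator {a..b} x *\<^sub>R f x) \<in> borel_measurable borel"
    by (rule borel_measurable_continuous_on_indicator) (auto intro: f)
  have K0: "0 \<le> K" using K[of 0] norm_ge_zero order_trans by blast
  show ?thesis unfolding set_integrable_def
  proof (rule integrableI_bounded_set[where A = "{a..b}" and B = "K * C"])
    have "(\<lambda>x. Q x * (indicator {a..b} x *\<^sub>R f x)) \<in> borel_measurable borel"
      using Q m by (rule borel_measurable_times)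
    then show "(\<lambda>x. indicator {a..b} x *\<^sub>R (Q x * f x)) \<in> borel_measurable lborel"
      by (simp add: mult_scaleR_right)
    show "AE x in lborel. x \<in> {a..b} \<longrightarrow> norm (indicator {a..b} x *\<^sub>R (Q x * f x)) \<le> K * C"
      using K C K0 by (auto simp: norm_mult intro!: mult_mono)
    show "emeasure lborel {a..b} < \<infinity>"
      by (cases "a \<le> b") auto
  qed auto
qed

text \<open>Integration from \<open>a\<close> reproduces the weight \<open>exp (2 * (s - a))\<close>
  with the factor 1/2. This factor is the contraction constant behind both uniqueness and existence
  below, on intervals of any length.\<close>

lemma norm_set_integral_exp_le:
  fixes f :: "real \<Rightarrow> complex"
  assumes f: "set_integrable lborel {a..x} f" and "a \<le> x" "0 \<le> B"
    and le: "\<And>s. s \<in> {a..x} \<Longrightarrow> norm (f s) \<le> B * exp (2 * (s - a))"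
  shows "norm (LINT s:{a..x}|lborel. f s) \<le> B / 2 * exp (2 * (x - a))"
proof -
  have hi: "((\<lambda>s. B * exp (2 * (s - a))) has_integral
      (B / 2 * exp (2 * (x - a)) - B / 2 * exp (2 * (a - a)))) {a..x}"
    by (rule fundamental_theorem_of_calculus[OF \<open>a \<le> x\<close>])
       (auto intro!: derivative_eq_intros simp flip: has_real_derivative_iff_has_vector_derivative)
  have "norm (integral {a..x} f) \<le> integral {a..x} (\<lambda>s. B * exp (2 * (s - a)))"
    using set_borel_integral_eq_integral[OF f] hi le
    by (intro Henstock_Kurzweil_Integration.integral_norm_bound_integral) auto
  also have "\<dots> \<le> B / 2 * exp (2 * (x - a))"
    using integral_unique[OF hi] \<open>0 \<le> B\<close> by simp
  finally show ?thesis
    using set_borel_integral_eq_integral[OF f] by simp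
qed

text \<open>Gronwall's argument with a weighted supremum: at a maximum point \<open>z\<close> of |w|
  times \<open>exp (- (2 * (x - a)))\<close> the equation gives
  \<open>g z \<le> g z / 2\<close>.\<close>

lemma volterra_cnj_zero:
  fixes Q w :: "real \<Rightarrow> complex"
  assumes Q: "Q \<in> borel_measurable borel" and Q1: "\<And>x. norm (Q x) \<le> 1"
    and w: "continuous_on {a..b} w"
    and eq: "\<And>x. x \<in> {a..b} \<Longrightarrow> w x = (LINT s:{a..x}|lborel. Q s * cnj (w s))"
    and x: "x \<in> {a..b}"
  shows "w x = 0"
proof -
  define g where "g x = norm (w x) * exp (- (2 * (x - a)))" for x
  have "continuous_on {a..b} g" unfolding g_def
    by (intro continuous_intros w)
  then obtain z where z: "z \<in> {a..b}" and zmax: "\<And>y. y \<in> {a..b} \<Longrightarrow> g y \<le> g z"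
    using continuous_attains_sup[of "{a..b}" g] x by auto
  have "norm (LINT s:{a..z}|lborel. Q s * cnj (w s)) \<le> g z / 2 * exp (2 * (z - a))"
  proof (rule norm_set_integral_exp_le)
    show "set_integrable lborel {a..z} (\<lambda>s. Q s * cnj (w s))"
      using z by (intro set_integrable_mult_continuous[OF Q Q1] continuous_intros
          continuous_on_subset[OF w]) auto
    show "0 \<le> g z" "a \<le> z" using z by (auto simp: g_def)
    fix s assume s: "s \<in> {a..z}"
    have "norm (Q s * cnj (w s)) \<le> 1 * norm (w s)"
      unfolding norm_mult complex_mod_cnj by (rule mult_right_mono[OF Q1]) simp
    also have "\<dots> = g s * exp (2 * (s - a))" by (simp add: g_def flip: exp_add)
    also have "\<dots> \<le> g z * exp (2 * (s - a))" using zmax[of s] s z by simp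
    finally show "norm (Q s * cnj (w s)) \<le> g z * exp (2 * (s - a))" .
  qed
  also have "g z / 2 * exp (2 * (z - a)) = norm (w z) / 2"
    by (simp add: g_def flip: exp_add)
  finally have "norm (w z) \<le> norm (w z) / 2"
    using eq[OF z] by simp
  then have "g z = 0" by (simp add: g_def)
  then have "g x \<le> 0" using zmax[OF x] by simp
  then show ?thesis by (simp add: g_def mult_le_0_iff)
qed

lemma continuous_on_set_integral_from_0:
  fixes f :: "real \<Rightarrow> complex"
  assumes f: "\<And>b. set_integrable lborel {0..b} f"
  shows "continuous_on UNIV (\<lambda>x. LINT s:{0..x}|lborel. f s)"
proof -
  have eq: "(LINT s:{0..x}|lborel. f s) = integral {0..x} f" for x
    using set_borel_integral_eq_integral[OF f] by simp
  \<comment> \<open>For negative \<open>x\<close> the interval \<open>{0..x}\<close> is empty and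
    the integral is 0, so two continuous pieces are glued at 0.\<close>
  have "continuous_on ({..0} \<union> {0..}) (\<lambda>x. integral {0..x} f)"
  proof (rule continuous_on_closed_Un)
    have "continuous_on {..0} (\<lambda>x::real. 0::complex)" by simp
    also have "?this \<longleftrightarrow> continuous_on {..0} (\<lambda>x. integral {0..x} f)"
    proof (rule continuous_on_cong[OF refl])
      fix x :: real assume "x \<in> {..0}"
      then consider "x = 0" | "x < 0" by force
      then show "0 = integral {0..x} f" by cases auto
    qed
    finally show "continuous_on {..0} (\<lambda>x. integral {0..x} f)" .
    show "continuous_on {0..} (\<lambda>x. integral {0..x} f)"
      unfolding continuous_on_eq_continuous_within
    proof
      fix x :: real assume x: "x \<in> {0..}"
      have "continuous_on {0..x+1} (\<lambda>x. integral {0..x} f)"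
        by (intro indefinite_integral_continuous_1 set_borel_integral_eq_integral f)
      then have "continuous (at x within {0..x+1}) (\<lambda>x. integral {0..x} f)"
        using x by (auto simp: continuous_on_eq_continuous_within)
      moreover have "at x within {0..x+1} = at x within {0..}"
        using x by (intro at_within_nhd[of _ "{..<x+1}"]) auto
      ultimately show "continuous (at x within {0..}) (\<lambda>x. integral {0..x} f)"
        by simp
    qed
  qed auto
  moreover have "{..0} \<union> {0..} = (UNIV :: real set)" by auto
  ultimately show ?thesis unfolding eq by simp
qed

text \<open>Banach's fixed point theorem for bounded continuous functions on the whole line, applied
  to \<open>z = y / e\<close>. The weight \<open>e\<close> makes the integral operator a contraction
  with constant 1/2; conjugation does no harm, because the estimate uses additivity only.\<close>

lemma volterra_cnj_exists:
  fixes Q :: "real \<Rightarrow> complex"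
  assumes Q: "Q \<in> borel_measurable borel" and Q1: "\<And>x. norm (Q x) \<le> 1"
  shows "\<exists>y. continuous_on UNIV y \<and>
    (\<forall>x. y x = 1 + (LINT s:{0..x}|lborel. Q s * cnj (y s)))"
proof -
  \<comment> \<open>The weight is 1 on the negative half line, where the integral vanishes and the
    solution is constant.\<close>
  define e :: "real \<Rightarrow> complex" where "e x = of_real (exp (2 * max x 0))" for x
  define G where "G z x = (1 + (LINT s:{0..x}|lborel. Q s * cnj (e s * z s))) / e x" for z x
  have ec: "continuous_on A e" for A
    unfolding e_def by (intro continuous_intros)
  have e0: "e x \<noteq> 0" and en: "norm (e x) = exp (2 * max x 0)" for x
    by (auto simp: e_def)
  have int: "set_integrable lborel {0..b} (\<lambda>s. Q s * cnj (e s * z s))"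
    if "continuous_on UNIV z" for z b
    by (intro set_integrable_mult_continuous[OF Q Q1] continuous_intros ec
        continuous_on_subset[OF that]) auto
  have bound: "norm ((LINT s:{0..x}|lborel. Q s * cnj (e s * z s)) / e x) \<le> B / 2"
    if z: "continuous_on UNIV z" and B: "\<And>x. norm (z x) \<le> B" for z x B
  proof (cases "0 \<le> x")
    case True
    have B0: "0 \<le> B" using B[of 0] norm_ge_zero order_trans by blast
    have "norm (LINT s:{0..x}|lborel. Q s * cnj (e s * z s)) \<le> B / 2 * exp (2 * (x - 0))"
    proof (rule norm_set_integral_exp_le[OF int[OF z] True B0])
      fix s assume s: "s \<in> {0..x}"
      have "norm (Q s) * (norm (e s) * norm (z s)) \<le> 1 * (norm (e s) * B)"
        by (intro mult_mono B Q1) auto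
      then show "norm (Q s * cnj (e s * z s)) \<le> B * exp (2 * (s - 0))"
        using s by (simp add: norm_mult en mult.commute)
    qed
    then show ?thesis using True by (simp add: norm_divide en divide_le_eq)
  next
    case False
    then show ?thesis
      using order_trans[OF norm_ge_zero B] by (simp add: set_lebesgue_integral_def)
  qed
  have GB: "G z \<in> bcontfun" if z: "z \<in> bcontfun" for z
  proof -
    from z obtain B where B: "\<And>x. norm (z x) \<le> B" and zc: "continuous_on UNIV z"
      by (auto simp: bcontfun_def bounded_iff)
    show ?thesis
    proof (rule bcontfun_normI)
      show "continuous_on UNIV (G z)" unfolding G_def
        by (intro continuous_intros continuous_on_set_integral_from_0 int[OF zc] ec)
           (use e0 in auto)
      fix x
      have "norm (1 / e x) \<le> 1" by (simp add: norm_divide en)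
      then show "norm (G z x) \<le> 1 + B / 2"
        unfolding G_def add_divide_distrib
        by (rule norm_triangle_mono[OF _ bound[OF zc B]])
    qed
  qed
  define F where "F z = Bcontfun (G (apply_bcontfun z))" for z
  have F: "apply_bcontfun (F z) x = G (apply_bcontfun z) x" for z x
    unfolding F_def using Bcontfun_inverse[OF GB[OF apply_bcontfun]] by simp
  have "\<exists>!z. F z = z"
  proof (rule banach_fix_type[where c = "1/2"])
    show "\<forall>x y. dist (F x) (F y) \<le> 1 / 2 * dist x y"
    proof (intro allI dist_bound)
      fix y z :: "real \<Rightarrow>\<^sub>C complex" and x :: real
      have cy: "continuous_on UNIV (apply_bcontfun y)" and cz: "continuous_on UNIV (apply_bcontfun z)"
        by auto
      have "norm ((LINT s:{0..x}|lborel. Q s * cnj (e s * (y s - z s))) / e x) \<le> dist y z / 2"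
        by (rule bound) (auto intro!: continuous_on_diff cy cz simp: dist_norm[symmetric] dist_bounded)
      also have "(LINT s:{0..x}|lborel. Q s * cnj (e s * (y s - z s))) =
          (LINT s:{0..x}|lborel. Q s * cnj (e s * y s)) - (LINT s:{0..x}|lborel. Q s * cnj (e s * z s))"
        by (subst set_integral_diff(2)[symmetric, OF int[OF cy] int[OF cz]]) (simp add: algebra_simps)
      finally show "dist (F y x) (F z x) \<le> 1 / 2 * dist y z"
        by (simp add: F G_def dist_norm diff_divide_distrib add_divide_distrib)
    qed
  qed auto
  then obtain z where z: "F z = z" by blast
  define y where "y x = e x * z x" for x
  have "y x = 1 + (LINT s:{0..x}|lborel. Q s * cnj (y s))" for x
    using F[of z x] e0[of x] unfolding z G_def y_def by (simp add: field_simps)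
  moreover have "continuous_on UNIV y"
    unfolding y_def by (intro continuous_on_mult ec continuous_on_apply_bcontfun)
  ultimately show ?thesis by blast
qed

subsection \<open>Global solutions and the transform\<close>

text \<open>One pair on the whole line, independent of the cutoff. Integration starts at 0, which
  suits potentials vanishing on the negative half line; for \<open>x < 0\<close> the equations read
  \<open>u x = 1\<close>, \<open>v x = 0\<close>.\<close>

definition nlft_solution ::
    "(real \<Rightarrow> complex) \<Rightarrow> real \<Rightarrow> (real \<Rightarrow> complex) \<Rightarrow> (real \<Rightarrow> complex) \<Rightarrow> bool" where
  "nlft_solution q k u v \<longleftrightarrow> continuous_on UNIV u \<and> continuous_on UNIV v \<and>
    (\<forall>x. u x = 1 + (LINT s:{0..x}|lborel. cnj (q s) * exp (- (\<i> * of_real (k * s))) * v s) \<and>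
         v x = (LINT s:{0..x}|lborel. q s * exp (\<i> * of_real (k * s)) * u s))"

lemma nlft_solutionD:
  assumes "nlft_solution q k u v"
  shows "continuous_on UNIV u" "continuous_on UNIV v"
    "u x = 1 + (LINT s:{0..x}|lborel. cnj (q s) * exp (- (\<i> * of_real (k * s))) * v s)"
    "v x = (LINT s:{0..x}|lborel. q s * exp (\<i> * of_real (k * s)) * u s)"
  using assms unfolding nlft_solution_def by blast+

lemma set_integral_cnj:
  "(LINT s:A|M. cnj (f s)) = cnj (LINT s:A|M. f s)"
proof -
  have "(\<lambda>x. indicator A x *\<^sub>R cnj (f x)) = (\<lambda>x. cnj (indicator A x *\<^sub>R f x))"
    by (auto simp: scaleR_conv_of_real)
  then show ?thesis unfolding set_lebesgue_integral_def by (simp del: complex_cnj_scaleR)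
qed

lemma kernel_borel_bounded:
  fixes q :: "real \<Rightarrow> complex"
  assumes "q \<in> borel_measurable borel" "\<And>x. norm (q x) \<le> 1"
  shows "(\<lambda>s. cnj (q s) * exp (- (\<i> * of_real (k * s)))) \<in> borel_measurable borel"
    and "norm (cnj (q s) * exp (- (\<i> * of_real (k * s)))) \<le> 1"
    and "(\<lambda>s. q s * exp (\<i> * of_real (k * s))) \<in> borel_measurable borel"
    and "norm (q s * exp (\<i> * of_real (k * s))) \<le> 1"
proof -
  have "continuous_on UNIV cnj" by (intro continuous_intros)
  then have cnj: "cnj \<in> borel_measurable borel"
    by (rule borel_measurable_continuous_onI)
  have "continuous_on UNIV (\<lambda>s. exp (\<i> * of_real (k * s)))"
    "continuous_on UNIV (\<lambda>s. exp (- (\<i> * of_real (k * s))))"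
    by (intro continuous_intros)+
  then have e: "(\<lambda>s. exp (\<i> * of_real (k * s))) \<in> borel_measurable borel"
    "(\<lambda>s. exp (- (\<i> * of_real (k * s)))) \<in> borel_measurable borel"
    by (auto intro: borel_measurable_continuous_onI)
  have "(\<lambda>s. cnj (q s)) \<in> borel_measurable borel"
    using measurable_compose[OF assms(1) cnj] .
  from borel_measurable_times[OF this e(2)]
  show "(\<lambda>s. cnj (q s) * exp (- (\<i> * of_real (k * s)))) \<in> borel_measurable borel" .
  from borel_measurable_times[OF assms(1) e(1)]
  show "(\<lambda>s. q s * exp (\<i> * of_real (k * s))) \<in> borel_measurable borel" .
qed (simp_all add: norm_mult assms(2))

text \<open>The combinations \<open>u + cnj v\<close> and \<open>u - cnj v\<close> decouple the system into the
  scalar equations \<open>y' = \<plusminus>Q cnj y\<close>.\<close>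

lemma nlft_solution_exists:
  assumes q: "q \<in> borel_measurable borel" "\<And>x. norm (q x) \<le> 1"
  obtains u v where "nlft_solution q k u v"
proof -
  define Q where "Q s = cnj (q s) * exp (- (\<i> * of_real (k * s)))" for s
  have Q: "Q \<in> borel_measurable borel" "\<And>x. norm (Q x) \<le> 1"
    unfolding Q_def using kernel_borel_bounded[OF q] by auto
  have nQ: "(\<lambda>s. - Q s) \<in> borel_measurable borel" "\<And>x. norm (- Q x) \<le> 1"
    using Q by auto
  obtain y where y: "continuous_on UNIV y" "\<And>x. y x = 1 + (LINT s:{0..x}|lborel. Q s * cnj (y s))"
    using volterra_cnj_exists[OF Q] by metis
  obtain z where z: "continuous_on UNIV z" "\<And>x. z x = 1 + (LINT s:{0..x}|lborel. - Q s * cnj (z s))"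
    using volterra_cnj_exists[OF nQ] by metis
  have iy: "set_integrable lborel {0..b} (\<lambda>s. Q s * cnj (y s))" for b
    by (intro set_integrable_mult_continuous[OF Q] continuous_intros continuous_on_subset[OF y(1)]) auto
  have iz: "set_integrable lborel {0..b} (\<lambda>s. - Q s * cnj (z s))" for b
    by (intro set_integrable_mult_continuous[OF nQ] continuous_intros continuous_on_subset[OF z(1)]) auto
  define u where "u x = (y x + z x) / 2" for x
  define v where "v x = cnj (y x - z x) / 2" for x
  have u: "u x = 1 + (LINT s:{0..x}|lborel. Q s * v s)" for x
  proof -
    have "(LINT s:{0..x}|lborel. Q s * v s) =
        (LINT s:{0..x}|lborel. (Q s * cnj (y s) + - Q s * cnj (z s)) / 2)"
      by (simp add: v_def algebra_simps)
    also have "\<dots> = ((y x - 1) + (z x - 1)) / 2"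
      by (subst set_integral_divide_zero, subst set_integral_add(2)[OF iy iz])
         (simp add: y(2)[of x] z(2)[of x])
    finally show ?thesis by (simp add: u_def field_simps)
  qed
  have v: "v x = (LINT s:{0..x}|lborel. cnj (Q s) * u s)" for x
  proof -
    have "(LINT s:{0..x}|lborel. cnj (Q s) * u s) =
        (LINT s:{0..x}|lborel. cnj ((Q s * cnj (y s) - - Q s * cnj (z s)) / 2))"
      by (simp add: u_def algebra_simps)
    also have "\<dots> = cnj (((y x - 1) - (z x - 1)) / 2)"
      by (subst set_integral_cnj, subst set_integral_divide_zero, subst set_integral_diff(2)[OF iy iz])
         (simp add: y(2)[of x] z(2)[of x])
    finally show ?thesis by (simp add: v_def)
  qed
  have Q_cnj: "cnj (Q s) = q s * exp (\<i> * of_real (k * s))" for s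
    by (simp add: Q_def exp_cnj)
  have "continuous_on UNIV u" "continuous_on UNIV v"
    unfolding u_def v_def by (intro continuous_intros y z; simp)+
  then have "nlft_solution q k u v"
    unfolding nlft_solution_def by (intro conjI allI u[unfolded Q_def] v[unfolded Q_cnj])
  then show thesis by (rule that)
qed

text \<open>Let \<open>U\<close> be the difference of the first components and \<open>V\<close> the
  conjugate difference of the second ones. Then \<open>U + V\<close> and \<open>U - V\<close> solve
  homogeneous scalar equations with kernels \<open>Q\<close> and \<open>- Q\<close>, so both
  vanish.\<close>

lemma nlft_unique:
  assumes p: "p \<in> borel_measurable borel" "\<And>x. norm (p x) \<le> 1"
    and c: "continuous_on {a..b} u" "continuous_on {a..b} v"
      "continuous_on {a..b} u'" "continuous_on {a..b} v'"
    and u: "\<And>x. x \<in> {a..b} \<Longrightarrow> u x = 1 + (LINT s:{a..x}|lborel. cnj (p s) * exp (- (\<i> * of_real (k * s))) * v s)"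
    and v: "\<And>x. x \<in> {a..b} \<Longrightarrow> v x = (LINT s:{a..x}|lborel. p s * exp (\<i> * of_real (k * s)) * u s)"
    and u': "\<And>x. x \<in> {a..b} \<Longrightarrow> u' x = 1 + (LINT s:{a..x}|lborel. cnj (p s) * exp (- (\<i> * of_real (k * s))) * v' s)"
    and v': "\<And>x. x \<in> {a..b} \<Longrightarrow> v' x = (LINT s:{a..x}|lborel. p s * exp (\<i> * of_real (k * s)) * u' s)"
    and x: "x \<in> {a..b}"
  shows "u x = u' x \<and> v x = v' x"
proof -
  define Q where "Q s = cnj (p s) * exp (- (\<i> * of_real (k * s)))" for s
  have Q: "Q \<in> borel_measurable borel" "\<And>x. norm (Q x) \<le> 1"
    unfolding Q_def using kernel_borel_bounded[OF p] by auto
  have cQ: "p s * exp (\<i> * of_real (k * s)) = cnj (Q s)" for s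
    by (simp add: Q_def exp_cnj)
  note u = u[folded Q_def] and u' = u'[folded Q_def]
  note v = v[unfolded cQ] and v' = v'[unfolded cQ]
  have int: "set_integrable lborel {a..y} (\<lambda>s. Q s * f s)"
    if "y \<in> {a..b}" "continuous_on {a..b} f" for f y
    using that by (intro set_integrable_mult_continuous[OF Q] continuous_on_subset[OF that(2)]) auto
  define U where "U x = u x - u' x" for x
  define V where "V x = cnj (v x - v' x)" for x
  have cU: "continuous_on {a..b} U" and cV: "continuous_on {a..b} V"
    unfolding U_def V_def by (intro continuous_intros c)+
  have U: "U y = (LINT s:{a..y}|lborel. Q s * cnj (V s))" if y: "y \<in> {a..b}" for y
    unfolding U_def V_def u[OF y] u'[OF y]
    by (simp add: right_diff_distrib set_integral_diff(2)[OF int[OF y c(2)] int[OF y c(4)]])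
  have V: "V y = (LINT s:{a..y}|lborel. Q s * cnj (U s))" if y: "y \<in> {a..b}" for y
  proof -
    have "V y = (LINT s:{a..y}|lborel. Q s * cnj (u s)) - (LINT s:{a..y}|lborel. Q s * cnj (u' s))"
      unfolding V_def v[OF y] v'[OF y] by (simp flip: set_integral_cnj)
    also have "\<dots> = (LINT s:{a..y}|lborel. Q s * cnj (U s))"
      unfolding U_def
      by (subst set_integral_diff(2)[symmetric]) (auto intro!: int[OF y] continuous_intros c simp: right_diff_distrib)
    finally show ?thesis .
  qed
  have "U x + V x = 0"
  proof (rule volterra_cnj_zero[OF Q _ _ x])
    show "U y + V y = (LINT s:{a..y}|lborel. Q s * cnj (U s + V s))" if y: "y \<in> {a..b}" for y
      unfolding U[OF y] V[OF y]
      by (subst set_integral_add(2)[symmetric]) (auto intro!: int[OF y] continuous_intros cU cV simp: algebra_simps)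
  qed (intro continuous_intros cU cV)
  moreover have "U x - V x = 0"
  proof (rule volterra_cnj_zero[where Q = "\<lambda>s. - Q s", OF _ _ _ _ x])
    show "U y - V y = (LINT s:{a..y}|lborel. - Q s * cnj (U s - V s))" if y: "y \<in> {a..b}" for y
      unfolding U[OF y] V[OF y]
      by (subst set_integral_diff(2)[symmetric]) (auto intro!: int[OF y] continuous_intros cU cV simp: algebra_simps)
  qed (use Q in \<open>auto intro!: continuous_intros cU cV\<close>)
  ultimately have "U x = 0" "V x = 0" by (auto simp: algebra_simps)
  then show ?thesis by (simp_all add: U_def V_def)
qed

text \<open>Up to the null set of the points \<open>T\<close> and \<open>- T\<close> the truncation
  changes nothing on the range of integration, and the part below 0 contributes nothing. The
  function \<open>h\<close> is conjugation in the equation for \<open>u\<close> and the identity in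
  that for \<open>v\<close>.\<close>

lemma trunc_set_integral:
  fixes q f :: "real \<Rightarrow> complex" and h :: "complex \<Rightarrow> complex"
  assumes q: "q \<in> borel_measurable borel" "\<And>s. s < 0 \<Longrightarrow> q s = 0"
    and f: "continuous_on UNIV f" and x: "x \<le> T"
    and h: "h \<in> borel_measurable borel" "h 0 = 0"
  shows "(LINT s:{-T..x}|lborel. h (trunc q T s) * f s) = (LINT s:{0..x}|lborel. h (q s) * f s)"
proof -
  note [measurable] = q(1) h(1) borel_measurable_continuous_onI[OF f]
  have [measurable]: "trunc q T \<in> borel_measurable borel"
    unfolding trunc_def[abs_def] by measurable
  have "AE s in lborel. s \<noteq> T \<and> s \<noteq> -T"
    using AE_lborel_singleton[of T] AE_lborel_singleton[of "-T"] by eventually_elim auto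
  then show ?thesis
    unfolding set_lebesgue_integral_def
    by (intro integral_cong_AE)
       (use x q(2) h(2) in \<open>auto simp: trunc_def indicator_def elim!: eventually_mono\<close>)
qed

text \<open>The restriction of the global solution to \<open>{-T..T}\<close> satisfies the defining
  equations of the truncated problem, and uniqueness makes the definite description select
  it.\<close>

lemma nlft_ab_eq_solution:
  assumes q: "q \<in> borel_measurable borel" "\<And>x. norm (q x) \<le> 1" "\<And>s. s < 0 \<Longrightarrow> q s = 0"
    and sol: "nlft_solution q k u v" and T: "0 \<le> T"
  shows "nlft_ab (trunc q T) k T = (u T, v T)"
proof -
  have cu: "continuous_on UNIV u" and cv: "continuous_on UNIV v"
    using nlft_solutionD[OF sol] by blast+
  have p: "trunc q T \<in> borel_measurable borel" "\<And>x. norm (trunc q T x) \<le> 1"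
    using q(1,2) unfolding trunc_def[abs_def] by auto
  have cnj: "cnj \<in> borel_measurable borel"
    by (intro borel_measurable_continuous_onI continuous_intros)
  have u: "u x = 1 + (LINT s:{-T..x}|lborel. cnj (trunc q T s) * exp (- (\<i> * of_real (k * s))) * v s)"
    if "x \<in> {-T..T}" for x
  proof -
    have "(LINT s:{-T..x}|lborel. cnj (trunc q T s) * (exp (- (\<i> * of_real (k * s))) * v s)) =
      (LINT s:{0..x}|lborel. cnj (q s) * (exp (- (\<i> * of_real (k * s))) * v s))"
      using that by (intro trunc_set_integral[where h = cnj and f = "\<lambda>s. exp (- (\<i> * of_real (k * s))) * v s"] q(1,3) cnj continuous_intros cv) auto
    then show ?thesis using nlft_solutionD(3)[OF sol, of x] by (simp only: mult.assoc)
  qed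
  have v: "v x = (LINT s:{-T..x}|lborel. trunc q T s * exp (\<i> * of_real (k * s)) * u s)"
    if "x \<in> {-T..T}" for x
  proof -
    have "(LINT s:{-T..x}|lborel. trunc q T s * (exp (\<i> * of_real (k * s)) * u s)) =
      (LINT s:{0..x}|lborel. q s * (exp (\<i> * of_real (k * s)) * u s))"
      using that by (intro trunc_set_integral[where h = "\<lambda>x. x" and f = "\<lambda>s. exp (\<i> * of_real (k * s)) * u s"] q(1,3) continuous_intros cu) auto
    then show ?thesis using nlft_solutionD(4)[OF sol, of x] by (simp only: mult.assoc)
  qed
  have c: "continuous_on {-T..T} u" "continuous_on {-T..T} v"
    using cu cv continuous_on_subset by blast+
  show ?thesis unfolding nlft_ab_def
  proof (rule the_equality)
    show "\<exists>u' v'. continuous_on {-T..T} u' \<and> continuous_on {-T..T} v' \<and>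
      (\<forall>x\<in>{-T..T}.
         u' x = 1 + (LINT s:{-T..x}|lborel. cnj (trunc q T s) * exp (- (\<i> * of_real (k * s))) * v' s) \<and>
         v' x = (LINT s:{-T..x}|lborel. trunc q T s * exp (\<i> * of_real (k * s)) * u' s)) \<and>
      (u T, v T) = (u' T, v' T)"
      by (rule exI[of _ u], rule exI[of _ v]) (intro conjI ballI c u v refl)
    fix ab
    assume "\<exists>u' v'. continuous_on {-T..T} u' \<and> continuous_on {-T..T} v' \<and>
      (\<forall>x\<in>{-T..T}.
         u' x = 1 + (LINT s:{-T..x}|lborel. cnj (trunc q T s) * exp (- (\<i> * of_real (k * s))) * v' s) \<and>
         v' x = (LINT s:{-T..x}|lborel. trunc q T s * exp (\<i> * of_real (k * s)) * u' s)) \<and>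
      ab = (u' T, v' T)"
    then obtain u' v' where c': "continuous_on {-T..T} u'" "continuous_on {-T..T} v'"
      and u': "\<And>x. x \<in> {-T..T} \<Longrightarrow>
         u' x = 1 + (LINT s:{-T..x}|lborel. cnj (trunc q T s) * exp (- (\<i> * of_real (k * s))) * v' s)"
      and v': "\<And>x. x \<in> {-T..T} \<Longrightarrow>
         v' x = (LINT s:{-T..x}|lborel. trunc q T s * exp (\<i> * of_real (k * s)) * u' s)"
      and ab: "ab = (u' T, v' T)"
      by (elim exE conjE) blast
    have "u T = u' T \<and> v T = v' T"
      by (rule nlft_unique[OF p c c' u v u' v']) (use T in auto)
    then show "ab = (u T, v T)" using ab by simp
  qed
qed

text \<open>The pieces of the potential live on half-open intervals. Replacing \<open>f\<close> by a
  continuous \<open>g\<close> that may differ from it at \<open>b\<close> gives one-sided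
  derivatives at both ends of the closed interval.\<close>

lemma has_vector_derivative_set_integral:
  fixes f :: "real \<Rightarrow> complex"
  assumes f: "\<And>b. set_integrable lborel {0..b} f" and ab: "0 \<le> a"
    and g: "continuous_on {a..b} g" "\<And>s. s \<in> {a..<b} \<Longrightarrow> f s = g s" and x: "x \<in> {a..b}"
  shows "((\<lambda>x. LINT s:{0..x}|lborel. f s) has_vector_derivative g x) (at x within {a..b})"
proof (rule has_vector_derivative_transform[OF x])
  show "(LINT s:{0..y}|lborel. f s) = integral {0..a} f + integral {a..y} g" if y: "y \<in> {a..b}" for y
  proof -
    have "(LINT s:{0..y}|lborel. f s) = integral {0..y} f"
      using set_borel_integral_eq_integral[OF f] by simp
    also have "\<dots> = integral {0..a} f + integral {a..y} f"
      using y ab set_borel_integral_eq_integral(1)[OF f]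
      by (intro Henstock_Kurzweil_Integration.integral_combine[symmetric]) auto
    also have "integral {a..y} f = integral {a..y} g"
      by (rule integral_spike[of "{b}"]) (use g(2) y in auto)
    finally show ?thesis .
  qed
  show "((\<lambda>y. integral {0..a} f + integral {a..y} g) has_vector_derivative g x) (at x within {a..b})"
    using has_vector_derivative_add[OF has_vector_derivative_const integral_has_vector_derivative[OF g(1) x]]
    by simp
qed

lemma nlft_solution_derivs:
  assumes q: "q \<in> borel_measurable borel" "\<And>x. norm (q x) \<le> 1"
    and sol: "nlft_solution q k u v" and a: "0 \<le> a"
    and g: "continuous_on {a..b} g" "\<And>s. s \<in> {a..<b} \<Longrightarrow> q s = g s" and x: "x \<in> {a..b}"
  shows "(u has_vector_derivative cnj (g x) * exp (- (\<i> * of_real (k * x))) * v x) (at x within {a..b})"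
    and "(v has_vector_derivative g x * exp (\<i> * of_real (k * x)) * u x) (at x within {a..b})"
proof -
  have cu: "continuous_on A u" and cv: "continuous_on A v" for A
    using nlft_solutionD[OF sol] continuous_on_subset by blast+
  have u: "(\<lambda>x. 1 + (LINT s:{0..x}|lborel. cnj (q s) * exp (- (\<i> * of_real (k * s))) * v s)) = u"
    and v: "(\<lambda>x. LINT s:{0..x}|lborel. q s * exp (\<i> * of_real (k * s)) * u s) = v"
    by (rule ext, rule nlft_solutionD(3)[OF sol, symmetric])
       (rule ext, rule nlft_solutionD(4)[OF sol, symmetric])
  note kb = kernel_borel_bounded[OF q, where k = k]
  have "((\<lambda>x. LINT s:{0..x}|lborel. cnj (q s) * exp (- (\<i> * of_real (k * s))) * v s)
      has_vector_derivative cnj (g x) * exp (- (\<i> * of_real (k * x))) * v x) (at x within {a..b})"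
    by (rule has_vector_derivative_set_integral[OF _ a _ _ x])
       (auto intro!: set_integrable_mult_continuous[OF kb(1,2)] continuous_intros cv g(1) simp: g(2) simp del: of_real_mult)
  from has_vector_derivative_add[OF has_vector_derivative_const[of 1] this]
  show "(u has_vector_derivative cnj (g x) * exp (- (\<i> * of_real (k * x))) * v x) (at x within {a..b})"
    unfolding u by simp
  have "((\<lambda>x. LINT s:{0..x}|lborel. q s * exp (\<i> * of_real (k * s)) * u s)
      has_vector_derivative g x * exp (\<i> * of_real (k * x)) * u x) (at x within {a..b})"
    by (rule has_vector_derivative_set_integral[OF _ a _ _ x])
       (auto intro!: set_integrable_mult_continuous[OF kb(3,4)] continuous_intros cu g(1) simp: g(2) simp del: of_real_mult)
  then show "(v has_vector_derivative g x * exp (\<i> * of_real (k * x)) * u x) (at x within {a..b})"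
    unfolding v .
qed

subsection \<open>Slow frequency sweeps\<close>

lemma has_vector_derivative_cis_comp:
  assumes "(f has_real_derivative f') (at x)"
  shows "((\<lambda>x. cis (f x)) has_vector_derivative \<i> * of_real f' * cis (f x)) (at x)"
  using assms
  by (auto simp: has_vector_derivative_def has_field_derivative_def scaleR_conv_of_real mult_ac
      intro!: derivative_eq_intros)

lemma norm_diff_le_of_derivative_le:
  fixes f :: "real \<Rightarrow> complex" and h :: "real \<Rightarrow> real"
  assumes "a \<le> b"
    and f: "continuous_on {a..b} f" "\<And>x. a < x \<Longrightarrow> x < b \<Longrightarrow> (f has_vector_derivative f' x) (at x)"
    and h: "\<And>x. x \<in> {a..b} \<Longrightarrow> (h has_real_derivative h' x) (at x)"
    and le: "\<And>x. x \<in> {a..b} \<Longrightarrow> norm (f' x) \<le> h' x"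
  shows "norm (f b - f a) \<le> h b - h a"
proof (cases "a = b")
  case False
  have "continuous_on {a..b} h"
    by (intro continuous_at_imp_continuous_on ballI DERIV_isCont[OF h])
  then show ?thesis
    using False assms
    by (intro differentiable_bound_general[of a b f h f' h'])
       (auto simp flip: has_real_derivative_iff_has_vector_derivative)
qed simp

text \<open>Normal form: with \<open>\<eta> = -\<i>c/d\<close> the variable \<open>U = u + \<eta> exp (-\<i>\<theta>) v\<close> satisfies
  \<open>U' = -\<i>(c\<^sup>2/d) U + O(c/d\<^sup>2) v\<close>, so away from the resonance \<open>d = 0\<close> the component \<open>u\<close> only
  rotates, by the angle \<open>\<integral> c\<^sup>2/d = \<gamma> ln (d(x\<^sub>0)/d(x\<^sub>1))\<close>.\<close>

lemma chirp_rotation_u: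
  fixes u v :: "real \<Rightarrow> complex" and \<theta> d :: "real \<Rightarrow> real"
  assumes x01: "x0 \<le> x1"
    and du: "\<And>x. x \<in> {x0..x1} \<Longrightarrow>
      (u has_vector_derivative of_real c * cis (- \<theta> x) * v x) (at x within {x0..x1})"
    and dv: "\<And>x. x \<in> {x0..x1} \<Longrightarrow>
      (v has_vector_derivative of_real c * cis (\<theta> x) * u x) (at x within {x0..x1})"
    and d\<theta>: "\<And>x. (\<theta> has_real_derivative d x) (at x)"
    and dd: "\<And>x. (d has_real_derivative - (2 * \<beta>)) (at x)"
    and D: "0 < D" "(\<forall>x\<in>{x0..x1}. D \<le> d x) \<or> (\<forall>x\<in>{x0..x1}. d x \<le> - D)"
    and M: "\<And>x. x \<in> {x0..x1} \<Longrightarrow> norm (u x) \<le> M \<and> norm (v x) \<le> M"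
    and c: "0 \<le> c" "c\<^sup>2 = 2 * \<beta> * \<gamma>" and \<gamma>: "0 \<le> \<gamma>" "\<gamma> \<le> 1" and \<beta>: "0 < \<beta>"
  shows "norm (u x1 - cis (- (\<gamma> * ln (d x0 / d x1))) * u x0) \<le> 4 * M * (c / D)"
proof -
  have d0: "d x \<noteq> 0" "D \<le> \<bar>d x\<bar>" "0 < d x0 / d x" if "x \<in> {x0..x1}" for x
  proof -
    have "x0 \<in> {x0..x1}" using x01 by simp
    then have "(D \<le> d x \<and> D \<le> d x0) \<or> (d x \<le> - D \<and> d x0 \<le> - D)"
      using D(2) that by blast
    then show "d x \<noteq> 0" "D \<le> \<bar>d x\<bar>" "0 < d x0 / d x"
      using D(1) by (auto simp: zero_less_divide_iff)
  qed
  have M0: "0 \<le> M" using M[of x0] x01 order_trans[OF norm_ge_zero] by force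
  define N where "N x = - (\<i> * of_real (c / d x)) * cis (- \<theta> x)" for x
  define U where "U x = u x + N x * v x" for x
  define P where "P x = \<gamma> * ln (d x0 / d x)" for x
  define G where "G x = cis (P x) * U x" for x
  \<comment> \<open>A primitive of the bound for |G'|: since \<open>d\<close> has slope
    \<open>- (2 * \<beta>)\<close>, the derivative of \<open>c / d x\<close> is
    \<open>2 * \<beta> * c / (d x)\<^sup>2\<close>.\<close>
  define h where "h x = (1 + \<gamma>) * M * (c / d x)" for x
  have dP: "(P has_real_derivative c\<^sup>2 / d x) (at x)" if x: "x \<in> {x0..x1}" for x
  proof -
    have x0: "d x0 \<noteq> 0" using d0(1)[of x0] x01 by simp
    show ?thesis
      unfolding P_def c(2) using d0(1,3)[OF x] x0
      by (auto intro!: derivative_eq_intros dd simp: field_simps power2_eq_square)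
  qed
  have dq: "((\<lambda>x. c / d x) has_real_derivative 2 * \<beta> * c / (d x)\<^sup>2) (at x)"
    if x: "x \<in> {x0..x1}" for x
    using d0(1)[OF x]
    by (auto intro!: derivative_eq_intros dd simp: field_simps power2_eq_square)
  have dN: "(N has_vector_derivative
      - (\<i> * of_real (2 * \<beta> * c / (d x)\<^sup>2)) * cis (- \<theta> x) - of_real c * cis (- \<theta> x)) (at x)"
    if x: "x \<in> {x0..x1}" for x
  proof -
    have 1: "((\<lambda>x. - (\<i> * of_real (c / d x))) has_vector_derivative
        - (\<i> * of_real (2 * \<beta> * c / (d x)\<^sup>2))) (at x)"
      using dq[OF x]
      by (intro derivative_intros has_vector_derivative_of_real)
    have 2: "((\<lambda>x. cis (- \<theta> x)) has_vector_derivative \<i> * of_real (- d x) * cis (- \<theta> x)) (at x)"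
      by (intro has_vector_derivative_cis_comp derivative_intros d\<theta>)
    show ?thesis
      unfolding N_def
      by (rule has_vector_derivative_eq_rhs[OF has_vector_derivative_mult[OF 1 2]])
         (use d0(1)[OF x] in \<open>simp add: algebra_simps\<close>)
  qed
  \<comment> \<open>The factor \<open>cis (P x)\<close> undoes the rotation, and the correction
    \<open>N\<close> cancels the oscillating term of order \<open>c\<close>. Only terms with
    \<open>(d x)\<^sup>2\<close> in the denominator remain.\<close>
  define G' where "G' x = cis (P x) * (of_real (c ^ 3 / (d x)\<^sup>2) - \<i> * of_real (2 * \<beta> * c / (d x)\<^sup>2))
      * cis (- \<theta> x) * v x" for x
  have dG: "(G has_vector_derivative G' x) (at x)" if x: "x0 < x" "x < x1" for x
  proof -
    have xi: "x \<in> {x0..x1}" using x by simp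
    have du': "(u has_vector_derivative of_real c * cis (- \<theta> x) * v x) (at x)"
      and dv': "(v has_vector_derivative of_real c * cis (\<theta> x) * u x) (at x)"
      using du[OF xi] dv[OF xi] x by (simp_all add: at_within_Icc_at)
    have dU: "(U has_vector_derivative of_real c * cis (- \<theta> x) * v x +
       (N x * (of_real c * cis (\<theta> x) * u x) + (- (\<i> * of_real (2 * \<beta> * c / (d x)\<^sup>2)) * cis (- \<theta> x)
         - of_real c * cis (- \<theta> x)) * v x)) (at x)"
      unfolding U_def
      by (intro has_vector_derivative_add has_vector_derivative_mult du' dv' dN xi)
    have cc: "cis (\<theta> x) * cis (- \<theta> x) = 1" by (simp add: cis_mult)
    have "of_real c * cis (- \<theta> x) * v x +
       (N x * (of_real c * cis (\<theta> x) * u x) + (- (\<i> * of_real (2 * \<beta> * c / (d x)\<^sup>2)) * cis (- \<theta> x)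
         - of_real c * cis (- \<theta> x)) * v x) = 
       - (\<i> * of_real (c\<^sup>2 / d x)) * u x * (cis (\<theta> x) * cis (- \<theta> x)) 
       - (\<i> * of_real (2 * \<beta> * c / (d x)\<^sup>2)) * cis (- \<theta> x) * v x"
      by (simp add: N_def algebra_simps power2_eq_square)
    also have "\<dots> = - (\<i> * of_real (c\<^sup>2 / d x)) * U x + (of_real (c ^ 3 / (d x)\<^sup>2)
        - \<i> * of_real (2 * \<beta> * c / (d x)\<^sup>2)) * cis (- \<theta> x) * v x"
      unfolding cc
      by (simp add: U_def N_def algebra_simps power2_eq_square power3_eq_cube)
    finally have dU': "(U has_vector_derivative - (\<i> * of_real (c\<^sup>2 / d x)) * U x
        + (of_real (c ^ 3 / (d x)\<^sup>2) - \<i> * of_real (2 * \<beta> * c / (d x)\<^sup>2)) * cis (- \<theta> x) * v x) (at x)"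
      using dU by simp
    show ?thesis
      unfolding G_def
      by (rule has_vector_derivative_eq_rhs[OF has_vector_derivative_mult[OF
            has_vector_derivative_cis_comp[OF dP[OF xi]] dU']])
         (simp add: G'_def algebra_simps)
  qed
  have cG: "continuous_on {x0..x1} G"
  proof -
    have "continuous_on {x0..x1} u" "continuous_on {x0..x1} v"
      unfolding continuous_on_eq_continuous_within
      using du dv has_vector_derivative_continuous by blast+
    moreover have "continuous_on {x0..x1} N" "continuous_on {x0..x1} P"
      by (intro continuous_at_imp_continuous_on ballI,
          use dN dP has_vector_derivative_continuous DERIV_isCont in blast)+
    ultimately show ?thesis
      unfolding G_def U_def by (intro continuous_intros)
  qed
  have "norm (G x1 - G x0) \<le> h x1 - h x0"
  proof (rule norm_diff_le_of_derivative_le[OF x01 cG dG])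
    fix x assume x: "x \<in> {x0..x1}"
    show "(h has_real_derivative (1 + \<gamma>) * M * (2 * \<beta> * c / (d x)\<^sup>2)) (at x)"
      unfolding h_def by (intro DERIV_cmult dq x)
    have "norm (of_real (c ^ 3 / (d x)\<^sup>2) - \<i> * of_real (2 * \<beta> * c / (d x)\<^sup>2) :: complex)
       \<le> c ^ 3 / (d x)\<^sup>2 + 2 * \<beta> * c / (d x)\<^sup>2"
      by (rule order_trans[OF norm_triangle_ineq4])
         (use c \<beta> in \<open>simp add: norm_mult norm_divide norm_power\<close>)
    also have "\<dots> = c\<^sup>2 * c / (d x)\<^sup>2 + 2 * \<beta> * c / (d x)\<^sup>2"
      by (simp add: power2_eq_square power3_eq_cube)
    \<comment> \<open>By \<open>c\<^sup>2 = 2 * \<beta> * \<gamma>\<close> the cubic term is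
      \<gamma> times the other one.\<close>
    also have "\<dots> = (1 + \<gamma>) * (2 * \<beta> * c / (d x)\<^sup>2)"
      unfolding c(2) by (simp add: algebra_simps add_divide_distrib)
    finally have "norm (of_real (c ^ 3 / (d x)\<^sup>2) - \<i> * of_real (2 * \<beta> * c / (d x)\<^sup>2) :: complex) * norm (v x)
       \<le> (1 + \<gamma>) * (2 * \<beta> * c / (d x)\<^sup>2) * M"
      using M[OF x] c \<beta> \<gamma> by (intro mult_mono) auto
    then show "norm (G' x) \<le> (1 + \<gamma>) * M * (2 * \<beta> * c / (d x)\<^sup>2)"
      unfolding G'_def norm_mult norm_cis by (simp add: mult_ac)
  qed auto
  also have "\<dots> \<le> (1 + \<gamma>) * M * (c / D)"
  proof -
    \<comment> \<open>Both detunings have the same sign, so one of the two terms is at most 0 and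
      the other at most \<open>c / D\<close>.\<close>
    have "c / d x1 - c / d x0 \<le> c / D"
      using D(2)
    proof
      assume *: "\<forall>x\<in>{x0..x1}. D \<le> d x"
      then have "D \<le> d x1" "D \<le> d x0" using x01 by auto
      then have "c / d x1 \<le> c / D" "0 \<le> c / d x0"
        using D(1) c(1) by (auto intro: frac_le)
      then show ?thesis by linarith
    next
      assume *: "\<forall>x\<in>{x0..x1}. d x \<le> - D"
      then have "d x0 \<le> - D" "d x1 \<le> - D" using x01 by simp_all
      then have "D \<le> - d x0" "d x1 \<le> - D" by simp_all
      then have "c / (- d x0) \<le> c / D" "c / d x1 \<le> 0"
        using D(1) c(1) by (auto intro!: divide_nonneg_nonpos simp del: divide_minus_right intro: frac_le)
      then show ?thesis by simp
    qed
    then have "(1 + \<gamma>) * M * (c / d x1 - c / d x0) \<le> (1 + \<gamma>) * M * (c / D)"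
      using M0 \<gamma> by (intro mult_left_mono) auto
    then show ?thesis by (simp add: h_def algebra_simps)
  qed
  also have "\<dots> \<le> 2 * M * (c / D)"
    using \<gamma> M0 c D(1) by (intro mult_right_mono) auto
  finally have G: "norm (G x1 - G x0) \<le> 2 * M * (c / D)" .
  have Nv: "norm (N x * v x) \<le> c / D * M" if x: "x \<in> {x0..x1}" for x
  proof -
    have "norm (N x) \<le> c / D" unfolding N_def
      using d0[OF x] D(1) c(1) by (auto simp: norm_mult norm_divide intro!: divide_left_mono)
    then show ?thesis unfolding norm_mult
      using M[OF x] c(1) D(1) by (intro mult_mono) auto
  qed
  have "u x1 - cis (- P x1) * u x0 =
      cis (- P x1) * (G x1 - G x0) - N x1 * v x1 + cis (- P x1) * (N x0 * v x0)"
  proof -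
    have "cis (- P x1) * G x1 = U x1"
      by (simp add: G_def cis_mult flip: mult.assoc)
    moreover have "G x0 = U x0"
      using d0(1)[of x0] x01 by (simp add: G_def P_def)
    ultimately show ?thesis by (simp add: U_def algebra_simps)
  qed
  also have "norm \<dots> \<le> norm (G x1 - G x0) + norm (N x1 * v x1) + norm (N x0 * v x0)"
    using norm_triangle_ineq[of "cis (- P x1) * (G x1 - G x0) - N x1 * v x1" "cis (- P x1) * (N x0 * v x0)"]
      norm_triangle_ineq4[of "cis (- P x1) * (G x1 - G x0)" "N x1 * v x1"]
    by (simp add: norm_mult)
  also have "\<dots> \<le> 4 * M * (c / D)"
  proof -
    have "4 * M * (c / D) = 2 * M * (c / D) + c / D * M + c / D * M" by algebra
    moreover have "x0 \<in> {x0..x1}" "x1 \<in> {x0..x1}" using x01 by auto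
    ultimately show ?thesis using G Nv by (metis add_mono)
  qed
  finally show ?thesis by (simp add: P_def)
qed

text \<open>\<open>(cnj v, cnj u)\<close> solves the same system.\<close>

lemma chirp_rotation_v:
  fixes u v :: "real \<Rightarrow> complex" and \<theta> d :: "real \<Rightarrow> real"
  assumes x01: "x0 \<le> x1"
    and du: "\<And>x. x \<in> {x0..x1} \<Longrightarrow>
      (u has_vector_derivative of_real c * cis (- \<theta> x) * v x) (at x within {x0..x1})"
    and dv: "\<And>x. x \<in> {x0..x1} \<Longrightarrow>
      (v has_vector_derivative of_real c * cis (\<theta> x) * u x) (at x within {x0..x1})"
    and d\<theta>: "\<And>x. (\<theta> has_real_derivative d x) (at x)"
    and dd: "\<And>x. (d has_real_derivative - (2 * \<beta>)) (at x)"
    and D: "0 < D" "(\<forall>x\<in>{x0..x1}. D \<le> d x) \<or> (\<forall>x\<in>{x0..x1}. d x \<le> - D)"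
    and M: "\<And>x. x \<in> {x0..x1} \<Longrightarrow> norm (u x) \<le> M \<and> norm (v x) \<le> M"
    and c: "0 \<le> c" "c\<^sup>2 = 2 * \<beta> * \<gamma>" and \<gamma>: "0 \<le> \<gamma>" "\<gamma> \<le> 1" and \<beta>: "0 < \<beta>"
  shows "norm (v x1 - cis (\<gamma> * ln (d x0 / d x1)) * v x0) \<le> 4 * M * (c / D)"
proof -
  have "norm (cnj (v x1) - cis (- (\<gamma> * ln (d x0 / d x1))) * cnj (v x0)) \<le> 4 * M * (c / D)"
  proof (rule chirp_rotation_u[OF x01 _ _ d\<theta> dd D _ c \<gamma> \<beta>])
    fix x assume x: "x \<in> {x0..x1}"
    show "((\<lambda>x. cnj (v x)) has_vector_derivative of_real c * cis (- \<theta> x) * cnj (u x)) (at x within {x0..x1})"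
      using has_vector_derivative_cnj[OF dv[OF x]] by (simp add: cis_cnj)
    show "((\<lambda>x. cnj (u x)) has_vector_derivative of_real c * cis (\<theta> x) * cnj (v x)) (at x within {x0..x1})"
      using has_vector_derivative_cnj[OF du[OF x]] by (simp add: cis_cnj)
    show "norm (cnj (v x)) \<le> M \<and> norm (cnj (u x)) \<le> M" using M[OF x] by simp
  qed
  also have "cnj (v x1) - cis (- (\<gamma> * ln (d x0 / d x1))) * cnj (v x0) =
     cnj (v x1 - cis (\<gamma> * ln (d x0 / d x1)) * v x0)"
    by (simp add: cis_cnj)
  finally show ?thesis unfolding complex_mod_cnj .
qed

section \<open>Passage of a solution through a single chirp\<close>

locale chirp_system =
  fixes u v :: "real \<Rightarrow> complex" and k s r m t :: real
  assumes s: "0 < s" "s \<le> 1" and r: "0 < r" "r \<le> 1" and m: "1 \<le> m"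
    and du: "\<And>x. x \<in> {t..t + m / r\<^sup>2} \<Longrightarrow>
      (u has_vector_derivative of_real (s * r) * cis (- (k * x + m * (x - t) - r\<^sup>2 * (x - t)\<^sup>2)) * v x)
        (at x within {t..t + m / r\<^sup>2})"
    and dv: "\<And>x. x \<in> {t..t + m / r\<^sup>2} \<Longrightarrow>
      (v has_vector_derivative of_real (s * r) * cis (k * x + m * (x - t) - r\<^sup>2 * (x - t)\<^sup>2) * u x)
        (at x within {t..t + m / r\<^sup>2})"
begin

text \<open>The derivative of the phase in \<open>du\<close> and \<open>dv\<close>. Over the block
  it decreases linearly from \<open>k + m\<close> to \<open>k - m\<close>, so it vanishes there
  exactly if |k| is at most \<open>m\<close>.\<close>

definition detuning :: "real \<Rightarrow> real" where
  "detuning x = k + m - 2 * r\<^sup>2 * (x - t)"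

end

locale chirp_block = chirp_system +
  fixes M :: real
  assumes M: "\<And>x. x \<in> {t..t + m / r\<^sup>2} \<Longrightarrow> norm (u x) \<le> M \<and> norm (v x) \<le> M"
begin

lemma M_nonneg: "0 \<le> M"
proof -
  have "t \<in> {t..t + m / r\<^sup>2}" using m by simp
  from M[OF this] show ?thesis by (meson norm_ge_zero order_trans)
qed

text \<open>The normal form estimate with \<open>c = s * r\<close>,
  \<open>\<beta> = r\<^sup>2\<close> and \<open>\<gamma> = s\<^sup>2 / 2\<close>. Since the detuning
  decreases, keeping it away from 0 on the interval needs a check at one endpoint only.\<close>

lemma rotation:
  assumes x: "t \<le> x0" "x0 \<le> x1" "x1 \<le> t + m / r\<^sup>2" and D: "0 < D"
    and sgn: "D \<le> detuning x1 \<or> detuning x0 \<le> - D"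
  shows "norm (u x1 - cis (- (s\<^sup>2 / 2 * ln (detuning x0 / detuning x1))) * u x0) \<le> 4 * M * (s * r / D)"
    and "norm (v x1 - cis (s\<^sup>2 / 2 * ln (detuning x0 / detuning x1)) * v x0) \<le> 4 * M * (s * r / D)"
proof -
  have sub: "{x0..x1} \<subseteq> {t..t + m / r\<^sup>2}" using x by auto
  have mono: "detuning y \<le> detuning x" if "x \<le> y" for x y
    using that mult_left_mono[of "x - t" "y - t" "2 * r\<^sup>2"] by (simp add: detuning_def)
  have sgn': "(\<forall>x\<in>{x0..x1}. D \<le> detuning x) \<or> (\<forall>x\<in>{x0..x1}. detuning x \<le> - D)"
    using sgn mono by (meson atLeastAtMost_iff order_trans)
  have th: "((\<lambda>x. k * x + m * (x - t) - r\<^sup>2 * (x - t)\<^sup>2) has_real_derivative detuning x) (at x)" for x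
    unfolding detuning_def by (auto intro!: derivative_eq_intros)
  have dd: "(detuning has_real_derivative - (2 * r\<^sup>2)) (at x)" for x
    unfolding detuning_def by (auto intro!: derivative_eq_intros)
  have c: "0 \<le> s * r" "(s * r)\<^sup>2 = 2 * r\<^sup>2 * (s\<^sup>2 / 2)" and g: "0 \<le> s\<^sup>2 / 2" "s\<^sup>2 / 2 \<le> 1" and b: "0 < r\<^sup>2"
    using s r power_le_one[of s 2] by (auto simp: power_mult_distrib)
  have du': "(u has_vector_derivative of_real (s * r) * cis (- (k * x + m * (x - t) - r\<^sup>2 * (x - t)\<^sup>2)) * v x)
        (at x within {x0..x1})"
    and dv': "(v has_vector_derivative of_real (s * r) * cis (k * x + m * (x - t) - r\<^sup>2 * (x - t)\<^sup>2) * u x)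
        (at x within {x0..x1})"
    and M': "norm (u x) \<le> M \<and> norm (v x) \<le> M" if "x \<in> {x0..x1}" for x
    by (rule has_vector_derivative_within_subset[OF du sub] has_vector_derivative_within_subset[OF dv sub] M,
        rule subsetD[OF sub that])+
  show "norm (u x1 - cis (- (s\<^sup>2 / 2 * ln (detuning x0 / detuning x1))) * u x0) \<le> 4 * M * (s * r / D)"
    by (rule chirp_rotation_u[OF x(2) du' dv' th dd D sgn' M' c g b])
  show "norm (v x1 - cis (s\<^sup>2 / 2 * ln (detuning x0 / detuning x1)) * v x0) \<le> 4 * M * (s * r / D)"
    by (rule chirp_rotation_v[OF x(2) du' dv' th dd D sgn' M' c g b])
qed

lemma rotation_norm:
  assumes "t \<le> x0" "x0 \<le> x1" "x1 \<le> t + m / r\<^sup>2" "0 < D"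
    and "D \<le> detuning x1 \<or> detuning x0 \<le> - D"
  shows "\<bar>norm (u x1) - norm (u x0)\<bar> \<le> 4 * M * (s * r / D)"
    and "\<bar>norm (v x1) - norm (v x0)\<bar> \<le> 4 * M * (s * r / D)"
  using rotation[OF assms] norm_triangle_ineq3[of "u x1" "cis (- (s\<^sup>2 / 2 * ln (detuning x0 / detuning x1))) * u x0"]
    norm_triangle_ineq3[of "v x1" "cis (s\<^sup>2 / 2 * ln (detuning x0 / detuning x1)) * v x0"]
  by (simp_all add: norm_mult)

text \<open>The direct derivative bound, for the short stretch around the resonance where the normal
  form is singular.\<close>

lemma step_norm:
  assumes x: "t \<le> x0" "x0 \<le> x1" "x1 \<le> t + m / r\<^sup>2"
  shows "\<bar>norm (u x1) - norm (u x0)\<bar> \<le> s * r * M * (x1 - x0)"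
    and "\<bar>norm (v x1) - norm (v x0)\<bar> \<le> s * r * M * (x1 - x0)"
proof -
  have bound: "norm (f x1 - f x0) \<le> s * r * M * (x1 - x0)"
    if d: "\<And>x. x \<in> {t..t + m / r\<^sup>2} \<Longrightarrow> (f has_vector_derivative f' x) (at x within {t..t + m / r\<^sup>2})"
      and le: "\<And>x. x \<in> {t..t + m / r\<^sup>2} \<Longrightarrow> norm (f' x) \<le> s * r * M" for f f' :: "real \<Rightarrow> complex"
  proof -
    have "continuous_on {t..t + m / r\<^sup>2} f"
      unfolding continuous_on_eq_continuous_within using d has_vector_derivative_continuous by blast
    then have cf: "continuous_on {x0..x1} f" by (rule continuous_on_subset) (use x in auto)
    have "(f has_vector_derivative f' y) (at y)" if "x0 < y" "y < x1" for y
      using d[of y] that x by (simp add: at_within_Icc_at)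
    from norm_diff_le_of_derivative_le[OF x(2) cf this, of "\<lambda>x. s * r * M * x" "\<lambda>x. s * r * M"]
    have "norm (f x1 - f x0) \<le> s * r * M * x1 - s * r * M * x0"
      using le x by (auto intro!: derivative_eq_intros)
    then show ?thesis by (simp add: algebra_simps)
  qed
  have "norm (u x1 - u x0) \<le> s * r * M * (x1 - x0)"
    by (rule bound[OF du]) (use M s r in \<open>auto simp: norm_mult intro!: mult_left_mono\<close>)
  then show "\<bar>norm (u x1) - norm (u x0)\<bar> \<le> s * r * M * (x1 - x0)"
    using norm_triangle_ineq3 order_trans by blast
  have "norm (v x1 - v x0) \<le> s * r * M * (x1 - x0)"
    by (rule bound[OF dv]) (use M s r in \<open>auto simp: norm_mult intro!: mult_left_mono\<close>)
  then show "\<bar>norm (v x1) - norm (v x0)\<bar> \<le> s * r * M * (x1 - x0)"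
    using norm_triangle_ineq3 order_trans by blast
qed

text \<open>The block is cut where the detuning is \<open>r\<close> and \<open>- r\<close>. Each
  outer part is a rotation up to an error \<open>4 * s * M\<close>. The middle part has length at
  most \<open>1 / r\<close> and contributes at most \<open>s * M\<close>.\<close>

lemma norm_variation_crude:
  assumes x: "x \<in> {t..t + m / r\<^sup>2}"
  shows "\<bar>norm (u x) - norm (u t)\<bar> \<le> 9 * s * M \<and> \<bar>norm (v x) - norm (v t)\<bar> \<le> 9 * s * M"
proof -
  define y where "y = t + (k + m - r) / (2 * r\<^sup>2)"
  define z where "z = t + (k + m + r) / (2 * r\<^sup>2)"
  have r2: "0 < r\<^sup>2" using r by simp
  have dety: "detuning y = r" and detz: "detuning z = - r"
    using r by (auto simp: detuning_def y_def z_def field_simps)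
  have yz: "y \<le> z" and len: "z - y = 1 / r"
    using r by (auto simp: y_def z_def field_simps power2_eq_square)
  have mono: "detuning b \<le> detuning a" if "a \<le> b" for a b
    using that mult_left_mono[of "a - t" "b - t" "2 * r\<^sup>2"] by (simp add: detuning_def)
  \<comment> \<open>The cut points are clamped to \<open>{t..x}\<close>, so that one argument covers
    all positions of the resonance, including its absence.\<close>
  define p where "p = max t (min x y)"
  define p' where "p' = max t (min x z)"
  have ord: "t \<le> p" "p \<le> p'" "p' \<le> x" "x \<le> t + m / r\<^sup>2" and pl: "p' - p \<le> 1 / r"
    using x yz len r by (auto simp: p_def p'_def)
  have sr: "4 * M * (s * r / r) = 4 * s * M" using r by (simp add: mult_ac)
  have ms: "0 \<le> 4 * s * M" using M_nonneg s by simp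
  have 1: "\<bar>norm (u p) - norm (u t)\<bar> \<le> 4 * s * M \<and> \<bar>norm (v p) - norm (v t)\<bar> \<le> 4 * s * M"
  proof (cases "p = t")
    case False
    then have "p \<le> y" using ord by (auto simp: p_def max_def min_def split: if_splits)
    then have "r \<le> detuning p" using mono dety by metis
    then show ?thesis using rotation_norm[of t p r, unfolded sr] ord r by auto
  qed (use ms in simp)
  have 2: "\<bar>norm (u x) - norm (u p')\<bar> \<le> 4 * s * M \<and> \<bar>norm (v x) - norm (v p')\<bar> \<le> 4 * s * M"
  proof (cases "p' = x")
    case False
    then have "z \<le> p'" using ord by (auto simp: p'_def max_def min_def split: if_splits)
    then have "detuning p' \<le> - r" using mono detz by metis
    then show ?thesis using rotation_norm[of p' x r, unfolded sr] ord r by auto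
  qed (use ms in simp)
  have "s * r * M * (p' - p) \<le> s * r * M * (1 / r)"
    using pl s r M_nonneg by (intro mult_left_mono) auto
  also have "\<dots> = s * M" using r by simp
  finally have 3: "\<bar>norm (u p') - norm (u p)\<bar> \<le> s * M \<and> \<bar>norm (v p') - norm (v p)\<bar> \<le> s * M"
    using step_norm[of p p'] ord by auto
  show ?thesis using 1 2 3 unfolding abs_le_iff by linarith
qed

text \<open>The decay in |k| is needed because the lower bound for |v| at \<open>x = 1\<close>
  decays at the same rate. For |k| below \<open>2 * m\<close> the crude bound suffices; otherwise
  the whole block is off resonance, with detuning at least |k| - m in absolute value.\<close>

lemma norm_variation:
  assumes x: "x \<in> {t..t + m / r\<^sup>2}"
  shows "\<bar>norm (u x) - norm (u t)\<bar> \<le> 9 * (2 * m + 1) * s * M / (1 + \<bar>k\<bar>)"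
    and "\<bar>norm (v x) - norm (v t)\<bar> \<le> 9 * (2 * m + 1) * s * M / (1 + \<bar>k\<bar>)"
proof -
  have sM: "0 \<le> s * M" using s M_nonneg by simp
  have "\<bar>norm (u x) - norm (u t)\<bar> \<le> 9 * (2 * m + 1) * s * M / (1 + \<bar>k\<bar>)
    \<and> \<bar>norm (v x) - norm (v t)\<bar> \<le> 9 * (2 * m + 1) * s * M / (1 + \<bar>k\<bar>)"
  proof (cases "\<bar>k\<bar> < 2 * m")
    case True
    have "1 + \<bar>k\<bar> \<noteq> 0" by linarith
    then have "9 * s * M = 9 * (1 + \<bar>k\<bar>) * (s * M) / (1 + \<bar>k\<bar>)"
      by (simp add: field_simps del: distrib_left_numeral)
    also have "\<dots> \<le> 9 * (2 * m + 1) * (s * M) / (1 + \<bar>k\<bar>)"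
      using True sM by (intro divide_right_mono mult_right_mono) auto
    finally have "9 * s * M \<le> 9 * (2 * m + 1) * s * M / (1 + \<bar>k\<bar>)" by (simp add: mult.assoc)
    then show ?thesis using norm_variation_crude[OF x] by auto
  next
    case False
    define D where "D = \<bar>k\<bar> - m"
    have D: "0 < D" "1 + \<bar>k\<bar> \<le> 4 * D" using False m by (auto simp: D_def)
    have "2 * r\<^sup>2 * (x - t) \<le> 2 * r\<^sup>2 * (m / r\<^sup>2)" using x by (intro mult_left_mono) auto
    also have "\<dots> = 2 * m" using r by simp
    finally have "2 * r\<^sup>2 * (x - t) \<le> 2 * m" .
    then have sgn: "D \<le> detuning x \<or> detuning t \<le> - D"
      unfolding detuning_def D_def by (cases "0 \<le> k") auto
    have "4 * M * (s * r / D) \<le> 4 * M * (s / D)"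
      using M_nonneg s r D by (intro mult_left_mono divide_right_mono) auto
    also have "\<dots> = 4 * (s * M) / D" by simp
    also have "\<dots> \<le> 4 * (s * M) / ((1 + \<bar>k\<bar>) / 4)"
      using D sM by (intro divide_left_mono) auto
    also have "\<dots> = 16 * (s * M) / (1 + \<bar>k\<bar>)" by simp
    also have "\<dots> \<le> 9 * (2 * m + 1) * (s * M) / (1 + \<bar>k\<bar>)"
      using m sM by (intro divide_right_mono mult_right_mono) auto
    finally have "4 * M * (s * r / D) \<le> 9 * (2 * m + 1) * s * M / (1 + \<bar>k\<bar>)" by (simp add: mult.assoc)
    then show ?thesis using rotation_norm[OF _ _ _ D(1) sgn] x by fastforce
  qed
  then show "\<bar>norm (u x) - norm (u t)\<bar> \<le> 9 * (2 * m + 1) * s * M / (1 + \<bar>k\<bar>)"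
    and "\<bar>norm (v x) - norm (v t)\<bar> \<le> 9 * (2 * m + 1) * s * M / (1 + \<bar>k\<bar>)" by auto
qed

text \<open>Between the detunings \<open>1\<close> and \<open>r\<close> the rotation angle is \<open>- s\<^sup>2/2 ln r = \<pi>\<close>.\<close>

lemma sign_flip:
  assumes k: "\<bar>k\<bar> \<le> m - 1" and lnr: "s\<^sup>2 * ln r = - (2 * pi)"
  shows "\<exists>x0\<ge>t. \<exists>x1\<ge>t. norm (u x1 + u x0) \<le> 4 * M * s \<and> norm (v x1 + v x0) \<le> 4 * M * s"
proof -
  \<comment> \<open>The points are found by solving for detuning 1 and \<open>r\<close>; the
    assumption on \<open>k\<close> places both inside the block.\<close>
  define x0 where "x0 = t + (k + m - 1) / (2 * r\<^sup>2)"
  define x1 where "x1 = t + (k + m - r) / (2 * r\<^sup>2)"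
  have det: "detuning x0 = 1" "detuning x1 = r"
    using r by (auto simp: detuning_def x0_def x1_def field_simps)
  have "(k + m - r) / (2 * r\<^sup>2) \<le> (2 * m) / (2 * r\<^sup>2)"
    using k r by (intro divide_right_mono) auto
  then have x1: "x1 \<le> t + m / r\<^sup>2" by (simp add: x1_def)
  have x0: "t \<le> x0" "x0 \<le> x1"
    using k r by (auto simp: x0_def x1_def intro!: divide_right_mono)
  have cis_minus_pi: "cis (- pi) = - 1" by (simp flip: cis_inverse)
  have "s\<^sup>2 / 2 * ln (detuning x0 / detuning x1) = pi"
    using lnr r by (simp add: det ln_div)
  with rotation[OF x0 x1 r(1)] have "norm (u x1 + u x0) \<le> 4 * M * s" "norm (v x1 + v x0) \<le> 4 * M * s"
    using r by (simp_all add: det cis_minus_pi)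
  then show ?thesis using x0 by (meson order_trans)
qed

end

text \<open>A bootstrap: with \<open>M\<close> the maximum over the block itself, the variation
  bound gives \<open>M \<le> 3 - e + e / 360 * M\<close>. This first forces \<open>M \<le> 3\<close>
  and then the sharper claim.\<close>

lemma (in chirp_system) norm_le_on_block:
  assumes t: "norm (u t) \<le> 3 - e" "norm (v t) \<le> 3 - e"
    and e: "0 < e" "e \<le> 1" "9 * (2 * m + 1) * s \<le> e / 360" and x: "x \<in> {t..t + m / r\<^sup>2}"
  shows "norm (u x) \<le> 3 - e / 2 \<and> norm (v x) \<le> 3 - e / 2"
proof -
  let ?I = "{t..t + m / r\<^sup>2}"
  have cont: "continuous_on ?I u" "continuous_on ?I v"
    unfolding continuous_on_eq_continuous_within using du dv has_vector_derivative_continuous by blast+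
  have "\<exists>z\<in>?I. \<forall>y\<in>?I. max (norm (u y)) (norm (v y)) \<le> max (norm (u z)) (norm (v z))"
    by (rule continuous_attains_sup) (use x in \<open>auto intro!: continuous_intros cont\<close>)
  then obtain z where z: "z \<in> ?I"
    and zmax: "\<And>y. y \<in> ?I \<Longrightarrow> max (norm (u y)) (norm (v y)) \<le> max (norm (u z)) (norm (v z))"
    by blast
  define M where "M = max (norm (u z)) (norm (v z))"
  interpret chirp_block u v k s r m t M
    by unfold_locales (use zmax in \<open>auto simp: M_def\<close>)
  have "9 * (2 * m + 1) * s * M / (1 + \<bar>k\<bar>) \<le> 9 * (2 * m + 1) * s * M / 1"
    using M_nonneg s m by (intro divide_left_mono) auto
  also have "\<dots> \<le> e / 360 * M"
    using mult_right_mono[OF e(3) M_nonneg] by simp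
  finally have "norm (u z) \<le> 3 - e + e / 360 * M" "norm (v z) \<le> 3 - e + e / 360 * M"
    using norm_variation[OF z] t by linarith+
  then have M1: "M \<le> 3 - e + e / 360 * M" by (simp add: M_def)
  have "M \<le> 3"
  proof (rule ccontr)
    assume "\<not> M \<le> 3"
    then have "3 * (1 - e / 360) < M * (1 - e / 360)" using e by (intro mult_strict_right_mono) auto
    with M1 e show False by (simp add: algebra_simps)
  qed
  then have "e / 360 * M \<le> e / 360 * 3" using e by (intro mult_left_mono) auto
  then have "M \<le> 3 - e / 2" using M1 e(1) by linarith
  then show ?thesis using M[OF x] by auto
qed

subsection \<open>The potential\<close>

text \<open>The upper bounds come from \<open>M \<le> 1 + M / 10\<close> for the maximum
  \<open>M\<close>. For the lower bound on |v|, integration by parts isolates the first-order term,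
  whose primitive \<open>E\<close> has a strictly smaller modulus at 1 than at 0; hence no
  \<open>k\<close> makes it vanish.\<close>

lemma bump_bounds:
  fixes u v :: "real \<Rightarrow> complex"
  assumes du: "\<And>x. x \<in> {0..1} \<Longrightarrow>
      (u has_vector_derivative of_real (exp (- x) / 10) * exp (- (\<i> * of_real (k * x))) * v x) (at x within {0..1})"
    and dv: "\<And>x. x \<in> {0..1} \<Longrightarrow>
      (v has_vector_derivative of_real (exp (- x) / 10) * exp (\<i> * of_real (k * x)) * u x) (at x within {0..1})"
    and init: "u 0 = 1" "v 0 = 0"
  shows "norm (u 1) \<le> 2" "norm (v 1) \<le> 2" "8 / 9 \<le> norm (u 1)" "1 / (30 * (1 + \<bar>k\<bar>)) \<le> norm (v 1)"
proof -
  let ?I = "{0..1::real}"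
  have cont: "continuous_on ?I u" "continuous_on ?I v"
    unfolding continuous_on_eq_continuous_within using du dv has_vector_derivative_continuous by blast+
  have "\<exists>z\<in>?I. \<forall>y\<in>?I. max (norm (u y)) (norm (v y)) \<le> max (norm (u z)) (norm (v z))"
    by (rule continuous_attains_sup) (auto intro!: continuous_intros cont)
  then obtain z where z: "z \<in> ?I"
    and zmax: "\<And>y. y \<in> ?I \<Longrightarrow> max (norm (u y)) (norm (v y)) \<le> max (norm (u z)) (norm (v z))"
    by blast
  define M where "M = max (norm (u z)) (norm (v z))"
  have M0: "0 \<le> M" by (simp add: M_def le_max_iff_disj)
  have M: "norm (u y) \<le> M" "norm (v y) \<le> M" if "y \<in> ?I" for y
    using zmax[OF that] by (auto simp: M_def)
  have du': "(u has_vector_derivative of_real (exp (- x) / 10) * exp (- (\<i> * of_real (k * x))) * v x) (at x)"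
    and dv': "(v has_vector_derivative of_real (exp (- x) / 10) * exp (\<i> * of_real (k * x)) * u x) (at x)"
    if "0 < x" "x < 1" for x
    using du[of x] dv[of x] that by (simp_all add: at_within_Icc_at)
  have bu: "norm (of_real (exp (- x) / 10) * exp (- (\<i> * of_real (k * x))) * v x) \<le> M / 10"
    and bv: "norm (of_real (exp (- x) / 10) * exp (\<i> * of_real (k * x)) * u x) \<le> M / 10"
    if x: "x \<in> ?I" for x
  proof -
    have "exp (- x) / 10 * norm (v x) \<le> 1 / 10 * M" "exp (- x) / 10 * norm (u x) \<le> 1 / 10 * M"
      using M[OF x] x by (intro mult_mono; simp)+
    then show "norm (of_real (exp (- x) / 10) * exp (- (\<i> * of_real (k * x))) * v x) \<le> M / 10"
      and "norm (of_real (exp (- x) / 10) * exp (\<i> * of_real (k * x)) * u x) \<le> M / 10"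
      by (simp_all add: norm_mult)
  qed
  have lin: "((\<lambda>y. M / 10 * y) has_real_derivative M / 10) (at x)" for x
    by (auto intro!: derivative_eq_intros)
  have u1: "norm (u x - u 0) \<le> M / 10" if x: "x \<in> ?I" for x
  proof -
    have "norm (u x - u 0) \<le> M / 10 * x - M / 10 * 0"
      using x by (intro norm_diff_le_of_derivative_le[OF _ _ du' lin bu] continuous_on_subset[OF cont(1)]) auto
    also have "\<dots> \<le> M / 10" using x M0 by (simp add: mult_left_le)
    finally show ?thesis .
  qed
  have v1: "norm (v x - v 0) \<le> M / 10" if x: "x \<in> ?I" for x
  proof -
    have "norm (v x - v 0) \<le> M / 10 * x - M / 10 * 0"
      using x by (intro norm_diff_le_of_derivative_le[OF _ _ dv' lin bv] continuous_on_subset[OF cont(2)]) auto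
    also have "\<dots> \<le> M / 10" using x M0 by (simp add: mult_left_le)
    finally show ?thesis .
  qed
  have "norm (u z) \<le> 1 + M / 10" using u1[OF z] norm_triangle_sub[of "u z" "u 0"] init by simp
  moreover have "norm (v z) \<le> 1 + M / 10" using v1[OF z] M0 init by simp
  ultimately have "M \<le> 1 + M / 10" by (simp add: M_def)
  then have M9: "M \<le> 10 / 9" by simp
  show "norm (u 1) \<le> 2" "norm (v 1) \<le> 2" using M[of 1] M9 by simp_all
  show "8 / 9 \<le> norm (u 1)" using u1[of 1] M9 norm_triangle_ineq2[of "u 0" "u 1"] init
    by (simp add: norm_minus_commute)
  \<comment> \<open>The exponent of the bump times the Fourier factor; its real part -1 keeps it
    away from 0 for every \<open>k\<close>.\<close>
  define w where "w = \<i> * of_real k - 1"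
  have "Re w = -1" by (simp add: w_def)
  then have w0: "w \<noteq> 0" by auto
  then have w: "0 < norm w" by simp
  have wk: "norm w \<le> 1 + \<bar>k\<bar>"
    using norm_triangle_ineq4[of "\<i> * of_real k" 1] by (simp add: w_def norm_mult)
  define E where "E x = exp (w * of_real x) / (10 * w)" for x
  have dE: "(E has_vector_derivative of_real (exp (- x) / 10) * exp (\<i> * of_real (k * x))) (at x)" for x
  proof -
    have "((\<lambda>x. exp (w * x) / (10 * w)) has_field_derivative exp (w * of_real x) / 10) (at (of_real x))"
      using w0 by (auto intro!: derivative_eq_intros)
    then have "(E has_vector_derivative exp (w * of_real x) / 10) (at x)"
      unfolding E_def by (rule has_vector_derivative_real_field)
    moreover have "exp (w * of_real x) = of_real (exp (- x)) * exp (\<i> * of_real (k * x))"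
      by (simp add: w_def left_diff_distrib exp_diff exp_minus exp_of_real field_simps)
    ultimately show ?thesis by simp
  qed
  have nE: "norm (E x) = exp (- x) / (10 * norm w)" for x
  proof -
    have "Re (w * of_real x) = - x" by (simp add: w_def)
    then show ?thesis by (simp add: E_def norm_divide norm_mult)
  qed
  \<comment> \<open>The terms with \<open>u\<close> cancel in the derivative, which leaves
    \<open>- E\<close> times the derivative of \<open>u\<close>, a second-order quantity.\<close>
  define H where "H x = v x - E x * u x" for x
  have "norm (H 1 - H 0) \<le> 1 / (90 * norm w) * 1 - 1 / (90 * norm w) * 0"
  proof (rule norm_diff_le_of_derivative_le[of 0 1 H
        "\<lambda>x. - E x * (of_real (exp (- x) / 10) * exp (- (\<i> * of_real (k * x))) * v x)"
        "\<lambda>x. 1 / (90 * norm w) * x" "\<lambda>x. 1 / (90 * norm w)"])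
    have "continuous_on ?I E"
      by (intro continuous_at_imp_continuous_on ballI) (use dE has_vector_derivative_continuous in blast)
    then show "continuous_on ?I H" unfolding H_def by (intro continuous_intros cont)
    show "(H has_vector_derivative - E x * (of_real (exp (- x) / 10) * exp (- (\<i> * of_real (k * x))) * v x)) (at x)"
      if x: "0 < x" "x < 1" for x
      unfolding H_def
      by (rule has_vector_derivative_eq_rhs[OF has_vector_derivative_diff[OF dv'[OF x]
            has_vector_derivative_mult[OF dE du'[OF x]]]]) simp
    show "((\<lambda>x. 1 / (90 * norm w) * x) has_real_derivative 1 / (90 * norm w)) (at x)" for x
      using w0 by (auto intro!: derivative_eq_intros)
    show "norm (- E x * (of_real (exp (- x) / 10) * exp (- (\<i> * of_real (k * x))) * v x)) \<le> 1 / (90 * norm w)"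
      if x: "x \<in> ?I" for x
    proof -
      have "norm (E x) \<le> 1 / (10 * norm w)"
        unfolding nE using x by (intro divide_right_mono) auto
      then have "norm (E x) * norm (of_real (exp (- x) / 10) * exp (- (\<i> * of_real (k * x))) * v x)
          \<le> 1 / (10 * norm w) * (1 / 9)"
        using bu[OF x] M9 w by (intro mult_mono) auto
      then show ?thesis by (simp only: norm_mult norm_minus_cancel) simp
    qed
  qed simp
  moreover have "norm (H 0) = 1 / (10 * norm w)"
    by (simp add: H_def init nE)
  moreover have "norm (E 1 * u 1) \<le> 1 / (20 * norm w) * (10 / 9)"
  proof -
    have "exp (- 1) \<le> (1 / 2 :: real)"
      using exp_ge_add_one_self[of 1] by (simp add: exp_minus field_simps)
    then have "exp (- 1) / (10 * norm w) \<le> (1 / 2) / (10 * norm w)"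
      using w by (intro divide_right_mono) auto
    then have "norm (E 1) \<le> 1 / (20 * norm w)" unfolding nE by simp
    then show ?thesis unfolding norm_mult using M[of 1] M9 w by (intro mult_mono) auto
  qed
  moreover have "v 1 = H 0 + (H 1 - H 0) + E 1 * u 1" by (simp add: H_def)
  then have "norm (H 0) \<le> norm (v 1) + norm (H 1 - H 0) + norm (E 1 * u 1)"
    using norm_triangle_ineq4[of "v 1 - (H 1 - H 0)" "E 1 * u 1"] norm_triangle_ineq4[of "v 1" "H 1 - H 0"]
    by simp
  ultimately have "1 / (10 * norm w) \<le> norm (v 1) + 1 / (90 * norm w) + 1 / (20 * norm w) * (10 / 9)"
    by simp
  \<comment> \<open>Here 1/10 - 1/90 - 1/18 = 1/30.\<close>
  then have "1 / (30 * norm w) \<le> norm (v 1)" by (simp add: field_simps)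
  moreover have "1 / (30 * (1 + \<bar>k\<bar>)) \<le> 1 / (30 * norm w)"
    using w wk by (intro divide_left_mono) auto
  ultimately show "1 / (30 * (1 + \<bar>k\<bar>)) \<le> norm (v 1)" by simp
qed

text \<open>Block \<open>n\<close> is \<open>[node n, node (n + 1))\<close>. There the potential has amplitude \<open>sig n * rho n\<close> and
  its local frequency sweeps \<open>[-(n + 1), n + 1]\<close> at rate \<open>2 (rho n)\<^sup>2\<close>. The choice of \<open>sig\<close> makes
  the total change of \<open>\<bar>u\<bar>\<close> and \<open>\<bar>v\<bar>\<close> over all blocks at most half the lower bound for \<open>\<bar>v\<bar>\<close> at \<open>x = 1\<close>,
  and \<open>rho\<close> is then small enough for a rotation by \<open>\<pi>\<close>.\<close>

definition sig :: "nat \<Rightarrow> real" where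
  "sig n = 1 / (3240 * (2 * real n + 3) * 2 ^ n)"

definition rho :: "nat \<Rightarrow> real" where
  "rho n = exp (- (2 * pi / (sig n)\<^sup>2))"

primrec node :: "nat \<Rightarrow> real" where
  "node 0 = 1"
| "node (Suc n) = node n + (real n + 1) / (rho n)\<^sup>2"

definition chirp :: "nat \<Rightarrow> real \<Rightarrow> complex" where
  "chirp n x = of_real (sig n * rho n) *
     cis ((real n + 1) * (x - node n) - (rho n)\<^sup>2 * (x - node n)\<^sup>2)"

definition pot :: "real \<Rightarrow> complex" where
  "pot x = indicator {0..<1} x *\<^sub>R of_real (exp (- x) / 10)
     + (\<Sum>n. indicator {node n..<node (Suc n)} x *\<^sub>R chirp n x)"

declare node.simps(2) [simp del]

text \<open>The factor 3240 = 9 * 360 is tuned to the hypothesis of \<open>norm_le_on_block\<close>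
  with \<open>m = n + 1\<close> and \<open>e = (1 / 2) ^ n\<close>. The bound on
  \<open>12 * sig n\<close> makes the sign-flip errors tend to 0, and the last one makes the masses
  of the blocks summable.\<close>

lemma sig_bounds: "0 < sig n" "sig n \<le> 1" "12 * sig n \<le> (1 / 2) ^ n"
  "9 * (2 * (real n + 1) + 1) * sig n = (1 / 2) ^ n / 360"
  "(real n + 1) * (sig n)\<^sup>2 \<le> (1 / 2) ^ n"
proof -
  show s0: "0 < sig n" by (simp add: sig_def)
  have 1: "3240 * (2 * real n + 3) * sig n = (1 / 2) ^ n"
    by (simp add: sig_def power_one_over divide_simps)
  then show "9 * (2 * (real n + 1) + 1) * sig n = (1 / 2) ^ n / 360" by (simp add: algebra_simps)
  have "12 * sig n \<le> 3240 * (2 * real n + 3) * sig n"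
    using s0 by (intro mult_right_mono) auto
  then show "12 * sig n \<le> (1 / 2) ^ n" using 1 by simp
  also have "\<dots> \<le> 1" by (simp add: power_le_one)
  finally show s1: "sig n \<le> 1" using s0 by simp
  have "(real n + 1) * (sig n)\<^sup>2 \<le> (3240 * (2 * real n + 3) * sig n) * 1"
    unfolding power2_eq_square mult.assoc[symmetric]
    using s0 s1 by (intro mult_mono mult_right_mono) auto
  then show "(real n + 1) * (sig n)\<^sup>2 \<le> (1 / 2) ^ n" using 1 by simp
qed

lemma rho_bounds: "0 < rho n" "rho n \<le> 1" "(sig n)\<^sup>2 * ln (rho n) = - (2 * pi)"
  using sig_bounds(1)[of n] by (auto simp: rho_def)

section \<open>The partition into blocks and the pointwise form of the potential\<close>

lemma node_Suc_ge: "node n + 1 \<le> node (Suc n)"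
proof -
  have "(rho n)\<^sup>2 \<le> 1" using rho_bounds[of n] by (simp add: power_le_one)
  then have "1 \<le> (real n + 1) / (rho n)\<^sup>2"
    using rho_bounds(1)[of n] by (simp add: divide_simps)
  then show ?thesis by (simp add: node.simps(2))
qed

lemma node_ge: "real n + 1 \<le> node n"
proof (induction n)
  case (Suc n)
  then show ?case using node_Suc_ge[of n] by simp
qed simp

lemma node_mono: "i \<le> j \<Longrightarrow> node i \<le> node j"
proof (rule lift_Suc_mono_le[of node])
  show "node n \<le> node (Suc n)" for n using node_Suc_ge[of n] by linarith
qed

lemma node_block_unique:
  assumes "x \<in> {node n..<node (Suc n)}" "x \<in> {node i..<node (Suc i)}"
  shows "i = n"
  using assms node_mono[of "Suc n" i] node_mono[of "Suc i" n]
  by (cases i n rule: linorder_cases) auto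

lemma node_block_exists:
  assumes "1 \<le> x"
  obtains n where "x \<in> {node n..<node (Suc n)}"
proof -
  define n where "n = (LEAST n. x < node (Suc n))"
  obtain i :: nat where "x < real i" using reals_Archimedean2 by blast
  then have "x < node (Suc i)" using node_ge[of "Suc i"] by simp
  then have n: "x < node (Suc n)" unfolding n_def by (rule LeastI)
  have "node n \<le> x"
  proof (cases n)
    case (Suc j)
    then have "\<not> x < node (Suc j)" using not_less_Least[of j "\<lambda>n. x < node (Suc n)"] by (simp add: n_def)
    then show ?thesis using Suc by simp
  qed (use assms in simp)
  then show thesis using n that by simp
qed

lemma suminf_block:
  fixes f :: "nat \<Rightarrow> 'a::real_normed_vector"
  assumes "x \<in> {node n..<node (Suc n)}"
  shows "(\<Sum>i. indicator {node i..<node (Suc i)} x *\<^sub>R f i) = f n"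
    and "summable (\<lambda>i. indicator {node i..<node (Suc i)} x *\<^sub>R f i)"
proof -
  have "indicator {node i..<node (Suc i)} x = (if i = n then 1 else 0 :: real)" for i
  proof -
    have "x \<in> {node i..<node (Suc i)} \<longleftrightarrow> i = n"
      using assms node_block_unique[OF assms] by blast
    then show ?thesis by (simp only: indicator_def of_bool_def)
  qed
  then have "(\<lambda>i. indicator {node i..<node (Suc i)} x *\<^sub>R f i) = (\<lambda>i. if i = n then f i else 0)"
    by auto
  then have "(\<lambda>i. indicator {node i..<node (Suc i)} x *\<^sub>R f i) sums f n"
    using sums_single[of n f] by simp
  then show "(\<Sum>i. indicator {node i..<node (Suc i)} x *\<^sub>R f i) = f n"
    "summable (\<lambda>i. indicator {node i..<node (Suc i)} x *\<^sub>R f i)"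
    by (auto simp: sums_iff)
qed

lemma suminf_block_0:
  fixes f :: "nat \<Rightarrow> 'a::real_normed_vector"
  assumes "x < 1"
  shows "(\<lambda>i. indicator {node i..<node (Suc i)} x *\<^sub>R f i) = (\<lambda>i. 0)"
proof -
  have "\<not> node i \<le> x" for i using node_ge[of i] assms by simp
  then show ?thesis by (auto simp: fun_eq_iff)
qed

lemma pot_eq:
  "x < 0 \<Longrightarrow> pot x = 0"
  "x \<in> {0..<1} \<Longrightarrow> pot x = of_real (exp (- x) / 10)"
  "x \<in> {node n..<node (Suc n)} \<Longrightarrow> pot x = chirp n x"
proof -
  show "pot x = chirp n x" if "x \<in> {node n..<node (Suc n)}"
    using that node_ge[of n] suminf_block(1)[OF that] by (simp add: pot_def)
qed (simp_all add: pot_def suminf_block_0)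

lemma norm_chirp: "norm (chirp n x) = sig n * rho n"
  using sig_bounds(1)[of n] rho_bounds(1)[of n] by (simp add: chirp_def norm_mult)

lemma norm_pot_le: "norm (pot x) \<le> 1"
proof -
  consider "x < 0" | "x \<in> {0..<1}" | "1 \<le> x" by force
  then show ?thesis
  proof cases
    case 2
    then have "exp (- x) \<le> 1" by simp
    then have "exp (- x) / 10 \<le> 1" by linarith
    then show ?thesis unfolding pot_eq(2)[OF 2] norm_of_real by simp
  next
    case 3
    then obtain n where "x \<in> {node n..<node (Suc n)}" by (rule node_block_exists)
    then show ?thesis using sig_bounds[of n] rho_bounds[of n]
      by (simp add: pot_eq(3) norm_chirp mult_le_one)
  qed (simp add: pot_eq(1))
qed

lemma continuous_on_chirp: "continuous_on A (chirp n)"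
  unfolding chirp_def[abs_def] by (intro continuous_intros)

lemma pot_measurable: "pot \<in> borel_measurable borel"
proof -
  have [measurable]: "chirp n \<in> borel_measurable borel" for n
    by (intro borel_measurable_continuous_onI continuous_on_chirp)
  show ?thesis unfolding pot_def[abs_def] by measurable
qed

text \<open>The mass of block \<open>n\<close> is its length
  \<open>(n + 1) / (rho n)\<^sup>2\<close> times the squared amplitude, that is
  \<open>(n + 1) * (sig n)\<^sup>2\<close>. Since \<open>rho\<close> cancels, it may be as small as
  the rotation by \<pi> demands.\<close>

lemma L2_fun_pot: "L2_fun pot"
proof -
  define g where "g n x = indicator {node n..<node (Suc n)} x *\<^sub>R (sig n * rho n)\<^sup>2" for n x
  have sq: "(norm (pot x))\<^sup>2 = indicator {0..<1} x *\<^sub>R (exp (- x) / 10)\<^sup>2 + (\<Sum>n. g n x)" for x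
  proof -
    consider "x < 0" | "x \<in> {0..<1}" | "1 \<le> x" by force
    then show ?thesis
    proof cases
      case 3
      then obtain n where n: "x \<in> {node n..<node (Suc n)}" by (rule node_block_exists)
      then show ?thesis using 3 unfolding g_def suminf_block(1)[OF n]
        by (simp add: pot_eq(3) norm_chirp)
    qed (use suminf_block_0[of x "\<lambda>n. (sig n * rho n)\<^sup>2"] in
        \<open>simp_all add: pot_eq(1,2) g_def norm_divide power_divide\<close>)
  qed
  have len: "node n \<le> node (Suc n)" for n using node_Suc_ge[of n] by simp
  have gi: "has_bochner_integral lborel (g n) ((real n + 1) * (sig n)\<^sup>2)" for n
  proof -
    have "has_bochner_integral lborel (g n) ((node (Suc n) - node n) *\<^sub>R (sig n * rho n)\<^sup>2)"
      unfolding g_def using has_bochner_integral_indicator[of "{node n..<node (Suc n)}" lborel "(sig n * rho n)\<^sup>2"] len[of n]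
      by (simp)
    moreover have "(node (Suc n) - node n) *\<^sub>R (sig n * rho n)\<^sup>2 = (real n + 1) * (sig n)\<^sup>2"
      using rho_bounds(1)[of n] by (simp add: node.simps(2) power_mult_distrib)
    ultimately show ?thesis by simp
  qed
  have g0: "norm (g n x) = g n x" for n x by (simp add: g_def)
  have "integrable lborel (\<lambda>x. \<Sum>n. g n x)"
  proof (rule integrable_suminf)
    show "integrable lborel (g n)" for n using gi by (auto simp: has_bochner_integral_iff)
    show "AE x in lborel. summable (\<lambda>n. norm (g n x))"
    proof (rule AE_I2)
      fix x
      show "summable (\<lambda>n. norm (g n x))"
      proof (cases "x < 1")
        case False
        then obtain n where n: "x \<in> {node n..<node (Suc n)}" using node_block_exists[of x] by auto
        show ?thesis unfolding g0 unfolding g_def by (rule suminf_block(2)[OF n])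
      qed (use suminf_block_0[of x "\<lambda>n. (sig n * rho n)\<^sup>2"] in \<open>simp add: g0 g_def\<close>)
    qed
    have "summable (\<lambda>n. (real n + 1) * (sig n)\<^sup>2)"
    proof (rule summable_comparison_test)
      show "\<exists>N. \<forall>n\<ge>N. norm ((real n + 1) * (sig n)\<^sup>2) \<le> (1 / 2) ^ n"
        using sig_bounds(5) by (intro exI[of _ 0]) auto
    qed (simp add: summable_geometric)
    then show "summable (\<lambda>n. LINT x|lborel. norm (g n x))"
      unfolding g0 has_bochner_integral_integral_eq[OF gi] .
  qed
  moreover have "integrable lborel (\<lambda>x. indicator {0..<1} x *\<^sub>R (exp (- x) / 10)\<^sup>2 :: real)"
  proof (rule integrableI_bounded_set[where A = "{0..<1}" and B = 1])
    show "AE x in lborel. x \<in> {0..<1} \<longrightarrow> norm (indicator {0..<1} x *\<^sub>R (exp (- x) / 10)\<^sup>2 :: real) \<le> 1"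
    proof (intro AE_I2 impI)
      fix x :: real assume "x \<in> {0..<1}"
      then have "exp (- x) \<le> 1" by simp
      then have "exp (- x) / 10 \<le> 1" by linarith
      then have "(exp (- x) / 10)\<^sup>2 \<le> 1" by (intro power_le_one) auto
      then show "norm (indicator {0..<1} x *\<^sub>R (exp (- x) / 10)\<^sup>2 :: real) \<le> 1"
        by (auto simp: indicator_def)
    qed
  qed auto
  ultimately show ?thesis
    unfolding L2_fun_def sq using pot_measurable by simp
qed

text \<open>Near a limit \<open>L\<close> the values at \<open>x0\<close> and \<open>x1\<close>
  almost agree and almost cancel, so \<open>2 * L\<close> is small. This contradicts the lower bound
  at the nodes: with all errors below \<open>\<delta> / 4\<close>, |L| is below 3/8 of \<delta> and
  |w| at the node below 5/8 of \<delta>.\<close>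

lemma not_tendsto_if_sign_flips:
  fixes w :: "real \<Rightarrow> complex"
  assumes flip: "\<And>n. N \<le> n \<Longrightarrow> \<exists>x0\<ge>node n. \<exists>x1\<ge>node n. norm (w x1 + w x0) \<le> 12 * sig n"
    and low: "\<And>n. \<delta> \<le> norm (w (node n))" and "0 < \<delta>"
  shows "\<not> (w \<longlongrightarrow> L) at_top"
proof
  assume "(w \<longlongrightarrow> L) at_top"
  then have "\<forall>\<^sub>F x in at_top. dist (w x) L < \<delta> / 4"
    using \<open>0 < \<delta>\<close> by (intro tendstoD) auto
  then obtain X where X: "\<And>x. X \<le> x \<Longrightarrow> norm (w x - L) < \<delta> / 4"
    by (auto simp: eventually_at_top_linorder dist_norm)
  have "(\<lambda>n. (1 / 2 :: real) ^ n) \<longlonglongrightarrow> 0" by (rule LIMSEQ_power_zero) simp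
  then have "\<forall>\<^sub>F n in sequentially. (1 / 2 :: real) ^ n < \<delta> / 4"
    using \<open>0 < \<delta>\<close> by (intro order_tendstoD(2)) auto
  moreover have "\<forall>\<^sub>F n in sequentially. X \<le> real n"
    using filterlim_real_sequentially by (simp add: filterlim_at_top)
  ultimately have "\<forall>\<^sub>F n in sequentially. (1 / 2 :: real) ^ n < \<delta> / 4 \<and> X \<le> real n \<and> N \<le> n"
    using eventually_ge_at_top[of N] by eventually_elim auto
  then obtain n where n: "(1 / 2 :: real) ^ n < \<delta> / 4" "X \<le> real n" "N \<le> n"
    using eventually_happens'[OF sequentially_bot] by blast
  obtain x0 x1 where x: "node n \<le> x0" "node n \<le> x1" "norm (w x1 + w x0) \<le> 12 * sig n"
    using flip[OF n(3)] by blast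
  have Xn: "X \<le> node n" using node_ge[of n] n(2) by simp
  have "norm (w x0 - L) < \<delta> / 4" "norm (w x1 - L) < \<delta> / 4" "norm (w (node n) - L) < \<delta> / 4"
    using X x Xn by auto
  moreover have "norm (2 * L) \<le> norm (w x1 + w x0) + norm (w x0 - L) + norm (w x1 - L)"
    using norm_triangle_ineq4[of "w x1 + w x0 - (w x0 - L)" "w x1 - L"]
      norm_triangle_ineq4[of "w x1 + w x0" "w x0 - L"] by (simp add: algebra_simps)
  moreover have "norm (w (node n)) \<le> norm L + norm (w (node n) - L)"
    using norm_triangle_sub by blast
  moreover have "norm (w x1 + w x0) < \<delta> / 4" using x(3) sig_bounds(3)[of n] n(1) by linarith
  ultimately show False using low[of n] \<open>0 < \<delta>\<close> by (simp add: norm_mult)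
qed

section \<open>The solution for the constructed potential\<close>

context
  fixes k :: real and u v :: "real \<Rightarrow> complex"
  assumes sol: "nlft_solution pot k u v"
begin

lemma solution_at_0: "u 0 = 1" "v 0 = 0"
proof -
  have "(LINT s:{0..0}|lborel. f s) = 0" for f :: "real \<Rightarrow> complex"
    unfolding set_lebesgue_integral_def
    by (intro integral_eq_zero_AE eventually_mono[OF AE_lborel_singleton[of 0]]) auto
  then show "u 0 = 1" "v 0 = 0"
    using nlft_solutionD(3,4)[OF sol, of 0] by simp_all
qed

lemma solution_at_1:
  "norm (u 1) \<le> 2" "norm (v 1) \<le> 2" "8 / 9 \<le> norm (u 1)" "1 / (30 * (1 + \<bar>k\<bar>)) \<le> norm (v 1)"
proof -
  have g: "continuous_on {0..1} (\<lambda>x. of_real (exp (- x) / 10) :: complex)"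
    by (intro continuous_intros) auto
  note d = nlft_solution_derivs[OF pot_measurable norm_pot_le sol order_refl g pot_eq(2)]
  have d': "x \<in> {0..1} \<Longrightarrow>
      (u has_vector_derivative of_real (exp (- x) / 10) * exp (- (\<i> * of_real (k * x))) * v x) (at x within {0..1})" 
    "x \<in> {0..1} \<Longrightarrow>
      (v has_vector_derivative of_real (exp (- x) / 10) * exp (\<i> * of_real (k * x)) * u x) (at x within {0..1})" for x
    using d[of x] by (simp_all only: complex_cnj_complex_of_real)
  show "norm (u 1) \<le> 2" "norm (v 1) \<le> 2" "8 / 9 \<le> norm (u 1)" "1 / (30 * (1 + \<bar>k\<bar>)) \<le> norm (v 1)"
    by (rule bump_bounds[OF d' solution_at_0]; assumption)+
qed

lemma chirp_system_block: "chirp_system u v k (sig n) (rho n) (real n + 1) (node n)"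
proof
  have n0: "0 \<le> node n" using node_ge[of n] by simp
  note d = nlft_solution_derivs[where b = "node (Suc n)",
      OF pot_measurable norm_pot_le sol n0 continuous_on_chirp pot_eq(3)]
  have e1: "chirp n x * exp (\<i> * of_real (k * x)) = of_real (sig n * rho n) *
     cis (k * x + (real n + 1) * (x - node n) - (rho n)\<^sup>2 * (x - node n)\<^sup>2)" for x
    unfolding chirp_def cis_conv_exp[symmetric] mult.assoc cis_mult by (simp add: algebra_simps)
  have e2: "cnj (chirp n x) * exp (- (\<i> * of_real (k * x))) = of_real (sig n * rho n) *
     cis (- (k * x + (real n + 1) * (x - node n) - (rho n)\<^sup>2 * (x - node n)\<^sup>2))" for x
    using arg_cong[OF e1[of x], of cnj] by (simp add: exp_cnj cis_cnj)
  show "(u has_vector_derivative of_real (sig n * rho n) *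
      cis (- (k * x + (real n + 1) * (x - node n) - (rho n)\<^sup>2 * (x - node n)\<^sup>2)) * v x)
      (at x within {node n..node n + (real n + 1) / (rho n)\<^sup>2})"
    if "x \<in> {node n..node n + (real n + 1) / (rho n)\<^sup>2}" for x
    using d(1)[of n x] that unfolding e2 node.simps by blast
  show "(v has_vector_derivative of_real (sig n * rho n) *
      cis (k * x + (real n + 1) * (x - node n) - (rho n)\<^sup>2 * (x - node n)\<^sup>2) * u x)
      (at x within {node n..node n + (real n + 1) / (rho n)\<^sup>2})"
    if "x \<in> {node n..node n + (real n + 1) / (rho n)\<^sup>2}" for x
    using d(2)[of n x] that unfolding e1 node.simps by blast
qed (use sig_bounds rho_bounds in auto)

text \<open>The bound 2 after the bump leaves a slack 1 below 3, and each block consumes at most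
  half of the remaining slack.\<close>

lemma solution_at_node_le: "norm (u (node n)) \<le> 3 - (1 / 2) ^ n \<and> norm (v (node n)) \<le> 3 - (1 / 2) ^ n"
proof (induction n)
  case 0
  show ?case using solution_at_1 by simp
next
  case (Suc n)
  interpret chirp_system u v k "sig n" "rho n" "real n + 1" "node n" by (rule chirp_system_block)
  have "norm (u (node (Suc n))) \<le> 3 - (1 / 2) ^ n / 2 \<and> norm (v (node (Suc n))) \<le> 3 - (1 / 2) ^ n / 2"
    using Suc sig_bounds(4)[of n] by (intro norm_le_on_block) (auto simp: power_le_one node.simps(2))
  then show ?case by simp
qed

lemma chirp_block_3: "chirp_block u v k (sig n) (rho n) (real n + 1) (node n) 3"
proof -
  interpret chirp_system u v k "sig n" "rho n" "real n + 1" "node n" by (rule chirp_system_block)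
  show ?thesis
  proof
    fix x assume x: "x \<in> {node n..node n + (real n + 1) / (rho n)\<^sup>2}"
    have "norm (u x) \<le> 3 - (1 / 2) ^ n / 2 \<and> norm (v x) \<le> 3 - (1 / 2) ^ n / 2"
      using solution_at_node_le[of n] sig_bounds(4)[of n] x by (intro norm_le_on_block) (auto simp: power_le_one)
    moreover have "0 \<le> (1 / 2 :: real) ^ n / 2" by simp
    ultimately show "norm (u x) \<le> 3 \<and> norm (v x) \<le> 3" by linarith
  qed
qed

text \<open>Block \<open>n\<close> costs at most \<open>(1 / 2) ^ n / 120\<close> divided by 1 +
  |k|. The partial sums stay below \<open>1 / 60\<close> over 1 + |k|, half of the lower bound for
  |v| at 1.\<close>

lemma solution_at_node_ge:
  "norm (u 1) - (1 - (1 / 2) ^ n) / (60 * (1 + \<bar>k\<bar>)) \<le> norm (u (node n)) \<and>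
   norm (v 1) - (1 - (1 / 2) ^ n) / (60 * (1 + \<bar>k\<bar>)) \<le> norm (v (node n))"
proof (induction n)
  case (Suc n)
  interpret chirp_block u v k "sig n" "rho n" "real n + 1" "node n" 3 by (rule chirp_block_3)
  have "node (Suc n) \<in> {node n..node n + (real n + 1) / (rho n)\<^sup>2}" by (simp add: node.simps(2))
  note var = norm_variation[OF this, unfolded sig_bounds(4)]
  have "(1 - (1 / 2) ^ Suc n) / (60 * (1 + \<bar>k\<bar>)) =
      (1 - (1 / 2) ^ n) / (60 * (1 + \<bar>k\<bar>)) + (1 / 2) ^ n / 360 * 3 / (1 + \<bar>k\<bar>)"
    using abs_ge_zero[of k] by (simp add: divide_simps) (simp add: algebra_simps)
  then show ?case using Suc var unfolding abs_le_iff by linarith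
qed simp

lemma solution_no_limit: "\<not> (u \<longlongrightarrow> L) at_top" "\<not> (v \<longlongrightarrow> L) at_top"
proof -
  have flip: "\<exists>x0\<ge>node n. \<exists>x1\<ge>node n. norm (u x1 + u x0) \<le> 12 * sig n \<and> norm (v x1 + v x0) \<le> 12 * sig n"
    if "nat \<lceil>\<bar>k\<bar>\<rceil> \<le> n" for n
  proof -
    interpret chirp_block u v k "sig n" "rho n" "real n + 1" "node n" 3 by (rule chirp_block_3)
    \<comment> \<open>From this block on, the sweep over \<open>[-(n + 1), n + 1]\<close> passes
      detuning 1 and then 0 at frequency \<open>k\<close>; the flip error \<open>4 * M * s\<close>
      is \<open>12 * sig n\<close> with \<open>M = 3\<close>.\<close>
    have "\<bar>k\<bar> \<le> real n + 1 - 1" using that by linarith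
    from sign_flip[OF this rho_bounds(3)] show ?thesis by simp
  qed
  have le: "(1 - (1 / 2) ^ n) / (60 * (1 + \<bar>k\<bar>)) \<le> 1 / (60 * (1 + \<bar>k\<bar>))" for n
    by (intro divide_right_mono) auto
  have "1 / (60 * (1 + \<bar>k\<bar>)) \<le> 1 / 60" by (simp add: divide_simps)
  then have "1 / 2 \<le> norm (u (node n))" for n
    using solution_at_node_ge[of n] le[of n] solution_at_1 by linarith
  then show "\<not> (u \<longlongrightarrow> L) at_top"
    using flip by (intro not_tendsto_if_sign_flips[where \<delta> = "1 / 2"]) (blast | simp)+
  define e where "e = 1 / (60 * (1 + \<bar>k\<bar>))"
  have e: "0 < e" "1 / (30 * (1 + \<bar>k\<bar>)) = 2 * e"
    unfolding e_def using abs_ge_zero[of k] by (simp add: add_pos_nonneg, simp add: divide_simps)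
  have "e \<le> norm (v (node n))" for n
    using solution_at_node_ge[of n] le[of n] solution_at_1(4) unfolding e(2) e_def[symmetric] by linarith
  then show "\<not> (v \<longlongrightarrow> L) at_top"
    using flip e(1) by (intro not_tendsto_if_sign_flips[where \<delta> = e]) blast+
qed

end

theorem theorem1p4:
  shows "\<exists>q :: real \<Rightarrow> complex. L2_fun q \<and>
    (\<forall>k :: real.
       \<not> (\<exists>L. ((\<lambda>T. nlft_a k q T) \<longlongrightarrow> L) at_top) \<and>
       \<not> (\<exists>L. ((\<lambda>T. nlft_b k q T) \<longlongrightarrow> L) at_top))"
proof (intro exI[of _ pot] conjI allI L2_fun_pot)
  fix k :: real
  obtain u v where sol: "nlft_solution pot k u v"
    using nlft_solution_exists[OF pot_measurable norm_pot_le] .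
  have ab: "nlft_ab (trunc pot T) k T = (u T, v T)" if "0 \<le> T" for T
    by (rule nlft_ab_eq_solution[OF pot_measurable norm_pot_le pot_eq(1) sol that])
  \<comment> \<open>The identification holds for nonnegative \<open>T\<close>, which is enough for
    limits at infinity.\<close>
  have "\<forall>\<^sub>F T in at_top. nlft_a k pot T = u T" "\<forall>\<^sub>F T in at_top. nlft_b k pot T = v T"
    using eventually_ge_at_top[of 0] by (eventually_elim; simp add: nlft_a_def nlft_b_def ab)+
  from this[THEN tendsto_cong] solution_no_limit[OF sol]
  show "\<not> (\<exists>L. ((\<lambda>T. nlft_a k pot T) \<longlongrightarrow> L) at_top)"
    "\<not> (\<exists>L. ((\<lambda>T. nlft_b k pot T) \<longlongrightarrow> L) at_top)"
    by blast+
qed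

end
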